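(* Let $\mathcal{G}$ be a groupoid and let $\mathrm{rep}(\mathcal{G}_0)\subseteq \mathcal{G}_0$ be a set of objects containing exactly one object from each connected component of $\mathcal{G}$. For $a\in\mathrm{rep}(\mathcal{G}_0)$ let $\mathcal{G}^{a}=\{g\in\mathcal{G}_1 : \mathsf{s}(g)=\mathsf{t}(g)=a\}$ be the isotropy group of $\mathcal{G}$ at $a$. Then there is a (non canonical) isomorphism of rings $$\mathscr{B}_{\mathsf{C}}(\mathcal{G})\;\cong\;\prod_{a\in\mathrm{rep}(\mathcal{G}_0)}\mathscr{B}_{\mathsf{C}}(\mathcal{G}^{a}),$$ where $\mathscr{B}_{\mathsf{C}}$ denotes the categorified Burnside ring and the right-hand side is the product of commutative rings.
   Context: A groupoid $\mathcal{G}$ is a small category all of whose morphisms are invertible, with set of objects $\mathcal{G}_0$, set of arrows $\mathcal{G}_1$, source $\mathsf{s}$, target $\mathsf{t}$, identities $\iota$. A right $\mathcal{G}$-set is a pair $(X,\varsigma)$ with $X$ a set, $\varsigma\colon X\to\mathcal{G}_0$ a map (the structure map), and an action sending each pair $(x,g)\in X\times\mathcal{G}_1$ with $\varsigma(x)=\mathsf{t}(g)$ to $xg\in X$, such that $\varsigma(xg)=\mathsf{s}(g)$, $x\iota_{\varsigma(x)}=x$, and $(xg)h=x(gh)$ whenever defined. A morphism ($\mathcal{G}$-equivariant map) $(X,\varsigma)\to(Y,\vartheta)$ is a map $F\colon X\to Y$ with $\vartheta F=\varsigma$ and $F(xg)=F(x)g$. The fibre product $(X,\varsigma)\times_{\mathcal{G}_0}(Y,\vartheta)$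 is $\{(x,y):\varsigma(x)=\vartheta(y)\}$ with structure map $(x,y)\mapsto\varsigma(x)$ and diagonal action. $\mathcal{G}_0$ is a right $\mathcal{G}$-set with structure map the identity and action $\mathsf{t}(g)\cdot g=\mathsf{s}(g)$. A group is regarded as a groupoid with one object. A categorified $\mathcal{G}$-set $(\mathcal{X},\varsigma)$ is an internal category in the category of right $\mathcal{G}$-sets: a small category $\mathcal{X}$ whose set of objects $(\mathcal{X}_0,\varsigma_0)$ and set of arrows $(\mathcal{X}_1,\varsigma_1)$ are right $\mathcal{G}$-sets and whose source, target, identity and composition maps are $\mathcal{G}$-equivariant. Morphisms are internal functors (functors $\varphi$ with $\varphi_0,\varphi_1$ equivariant); 2-morphisms $\varphi\to\psi$ (for $\varphi,\psi\colon\mathcal{X}\to\mathcal{Y}$) are internal natural transformations (natural transformations given by an equivariant map $\mathcal{X}_0\to\mathcal{Y}_1$). Two categorified $\mathcal{G}$-sets $\mathcal{X},\mathcal{Y}$ are weakly equivalent if there are morphisms $\varphi\colon\mathcal{X}\to\mathcal{Y}$, $\psi\colon\mathcal{Y}\to\mathcal{X}$ and invertible 2-morphisms $\psi\varphi\to\mathrm{Id}_{\mathcal{X}}$, $\varphi\psi\to\mathrm{Id}_{\mathcal{Y}}$. Disjoint union $\uplus$ and fibre product $\times_{\mathcal{G}_0}$ of categorified $\mathcal{G}$-sets are formed levelwise on objects and arrows. A categorified $\mathcal{G}$-set $\mathcal{X}$ is called finite if $\mathcal{X}_1$ is finite. The categorified Burnside rig $\mathscr{L}_{\mathsf{C}}(\mathcal{G})$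 (a rig being a unital commutative semiring) consists of the weak equivalence classes of finite categorified $\mathcal{G}$-sets, with addition induced by $\uplus$ (zero: the class of $\emptyset$) and multiplication induced by $\times_{\mathcal{G}_0}$ (whose monoidal unit is $\mathcal{G}_0$ viewed as a discrete category). The categorified Burnside ring $\mathscr{B}_{\mathsf{C}}(\mathcal{G})$ is its Grothendieck ring (the universal commutative ring receiving a rig homomorphism from $\mathscr{L}_{\mathsf{C}}(\mathcal{G})$; elements are classes $[x,y]$ with $[x,y]=[x',y']$ iff $x+y'+e=x'+y+e$ for some $e$).
   Formalization: The formal theorem assumes that the set of objects G_0 is finite; otherwise the unit G_0 is not a finite categorified G-set, and the claim fails, e.g. for the pair groupoid on an infinite set, where the left side is 0 and the right side is not. *)

theory Defs
  imports "HOL-Algebra.QuotRing"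
begin

section \<open>Small categories and groupoids\<close>

record ('o, 'a) small_cat =
  Obj :: "'o set"
  Arr :: "'a set"
  Src :: "'a \<Rightarrow> 'o"
  Trg :: "'a \<Rightarrow> 'o"
  Ide :: "'o \<Rightarrow> 'a"
  Cmp :: "'a \<Rightarrow> 'a \<Rightarrow> 'a"

text \<open>Composition is written in the order of functions: \<open>Cmp C f g\<close> is "first \<open>g\<close>, then \<open>f\<close>", and is
  meaningful when \<open>Src C f = Trg C g\<close>. All fields are only meaningful on \<open>Obj C\<close> and \<open>Arr C\<close>.\<close>

locale small_category =
  fixes C :: "('o, 'a, 'm) small_cat_scheme"
  assumes Src_closed: "f \<in> Arr C \<Longrightarrow> Src C f \<in> Obj C"
    and Trg_closed: "f \<in> Arr C \<Longrightarrow> Trg C f \<in> Obj C"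
    and Ide_closed: "x \<in> Obj C \<Longrightarrow> Ide C x \<in> Arr C"
    and Src_Ide: "x \<in> Obj C \<Longrightarrow> Src C (Ide C x) = x"
    and Trg_Ide: "x \<in> Obj C \<Longrightarrow> Trg C (Ide C x) = x"
    and Cmp_closed: "\<lbrakk>f \<in> Arr C; g \<in> Arr C; Src C f = Trg C g\<rbrakk> \<Longrightarrow> Cmp C f g \<in> Arr C"
    and Src_Cmp: "\<lbrakk>f \<in> Arr C; g \<in> Arr C; Src C f = Trg C g\<rbrakk> \<Longrightarrow> Src C (Cmp C f g) = Src C g"
    and Trg_Cmp: "\<lbrakk>f \<in> Arr C; g \<in> Arr C; Src C f = Trg C g\<rbrakk> \<Longrightarrow> Trg C (Cmp C f g) = Trg C f"
    and Cmp_Ide_left: "f \<in> Arr C \<Longrightarrow> Cmp C (Ide C (Trg C f)) f = f"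
    and Cmp_Ide_right: "f \<in> Arr C \<Longrightarrow> Cmp C f (Ide C (Src C f)) = f"
    and Cmp_assoc: "\<lbrakk>f \<in> Arr C; g \<in> Arr C; h \<in> Arr C; Src C f = Trg C g; Src C g = Trg C h\<rbrakk>
      \<Longrightarrow> Cmp C (Cmp C f g) h = Cmp C f (Cmp C g h)"

locale groupoid = small_category G for G :: "('o, 'g, 'm) small_cat_scheme" +
  assumes invertible: "g \<in> Arr G \<Longrightarrow>
    \<exists>h\<in>Arr G. Src G h = Trg G g \<and> Trg G h = Src G g \<and>
      Cmp G g h = Ide G (Trg G g) \<and> Cmp G h g = Ide G (Src G g)"

text \<open>The isotropy group at \<open>a\<close>, regarded as a groupoid with the single object \<open>a\<close>.\<close>

definition isotropy :: "('o, 'g) small_cat \<Rightarrow> 'o \<Rightarrow> ('o, 'g) small_cat" where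
  "isotropy G a = G\<lparr>Obj := {a}, Arr := {g \<in> Arr G. Src G g = a \<and> Trg G g = a}\<rparr>"

text \<open>Two objects of a groupoid lie in the same connected component iff there is an arrow between them.\<close>

definition component_representatives :: "('o, 'g) small_cat \<Rightarrow> 'o set \<Rightarrow> bool" where
  "component_representatives G R \<longleftrightarrow> R \<subseteq> Obj G \<and>
    (\<forall>x\<in>Obj G. \<exists>!a. a \<in> R \<and> (\<exists>g\<in>Arr G. Src G g = x \<and> Trg G g = a))"


section \<open>Right sets over a groupoid\<close>

record ('x, 'o, 'g) gset =
  Pts :: "'x set"
  Str :: "'x \<Rightarrow> 'o"
  Act :: "'x \<Rightarrow> 'g \<Rightarrow> 'x"

definition right_gset :: "('o, 'g) small_cat \<Rightarrow> ('x, 'o, 'g) gset \<Rightarrow> bool" where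
  "right_gset G X \<longleftrightarrow>
    (\<forall>x\<in>Pts X. Str X x \<in> Obj G) \<and>
    (\<forall>x\<in>Pts X. \<forall>g\<in>Arr G. Str X x = Trg G g \<longrightarrow>
      Act X x g \<in> Pts X \<and> Str X (Act X x g) = Src G g) \<and>
    (\<forall>x\<in>Pts X. Act X x (Ide G (Str X x)) = x) \<and>
    (\<forall>x\<in>Pts X. \<forall>g\<in>Arr G. \<forall>h\<in>Arr G. Str X x = Trg G g \<longrightarrow> Src G g = Trg G h \<longrightarrow>
      Act X (Act X x g) h = Act X x (Cmp G g h))"

definition equivariant ::
  "('o, 'g) small_cat \<Rightarrow> ('x, 'o, 'g) gset \<Rightarrow> ('y, 'o, 'g) gset \<Rightarrow> ('x \<Rightarrow> 'y) \<Rightarrow> bool" where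
  "equivariant G X Y F \<longleftrightarrow>
    (\<forall>x\<in>Pts X. F x \<in> Pts Y \<and> Str Y (F x) = Str X x) \<and>
    (\<forall>x\<in>Pts X. \<forall>g\<in>Arr G. Str X x = Trg G g \<longrightarrow> F (Act X x g) = Act Y (F x) g)"


section \<open>Categorified sets over a groupoid\<close>

record ('x, 'y, 'o, 'g) cgset = "('x, 'y) small_cat" +
  ObjStr :: "'x \<Rightarrow> 'o"
  ObjAct :: "'x \<Rightarrow> 'g \<Rightarrow> 'x"
  ArrStr :: "'y \<Rightarrow> 'o"
  ArrAct :: "'y \<Rightarrow> 'g \<Rightarrow> 'y"

definition obj_gset :: "('x, 'y, 'o, 'g) cgset \<Rightarrow> ('x, 'o, 'g) gset" where
  "obj_gset X = \<lparr>Pts = Obj X, Str = ObjStr X, Act = ObjAct X\<rparr>"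

definition arr_gset :: "('x, 'y, 'o, 'g) cgset \<Rightarrow> ('y, 'o, 'g) gset" where
  "arr_gset X = \<lparr>Pts = Arr X, Str = ArrStr X, Act = ArrAct X\<rparr>"

text \<open>The domain of the composition map: the pullback of the source and target maps in right
  \<open>G\<close>-sets. Both components of a composable pair have the same structure value when source and target
  are equivariant.\<close>

definition composable_gset :: "('x, 'y, 'o, 'g) cgset \<Rightarrow> ('y \<times> 'y, 'o, 'g) gset" where
  "composable_gset X =
    \<lparr>Pts = {(p, q). p \<in> Arr X \<and> q \<in> Arr X \<and> Src X p = Trg X q},
     Str = (\<lambda>(p, q). ArrStr X p),
     Act = (\<lambda>(p, q) g. (ArrAct X p g, ArrAct X q g))\<rparr>"

definition categorified_gset :: "('o, 'g) small_cat \<Rightarrow> ('x, 'y, 'o, 'g) cgset \<Rightarrow> bool" where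
  "categorified_gset G X \<longleftrightarrow>
    small_category X \<and>
    right_gset G (obj_gset X) \<and> right_gset G (arr_gset X) \<and>
    equivariant G (arr_gset X) (obj_gset X) (Src X) \<and>
    equivariant G (arr_gset X) (obj_gset X) (Trg X) \<and>
    equivariant G (obj_gset X) (arr_gset X) (Ide X) \<and>
    equivariant G (composable_gset X) (arr_gset X) (\<lambda>(p, q). Cmp X p q)"

definition finite_cgset :: "('o, 'g) small_cat \<Rightarrow> ('x, 'y, 'o, 'g) cgset \<Rightarrow> bool" where
  "finite_cgset G X \<longleftrightarrow> categorified_gset G X \<and> finite (Arr X)"

text \<open>Morphisms are given by a pair (map on objects, map on arrows).\<close>

definition internal_functor ::
  "('o, 'g) small_cat \<Rightarrow> ('x, 'y, 'o, 'g) cgset \<Rightarrow> ('u, 'v, 'o, 'g) cgset \<Rightarrow>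
    ('x \<Rightarrow> 'u) \<times> ('y \<Rightarrow> 'v) \<Rightarrow> bool" where
  "internal_functor G X Y \<phi> \<longleftrightarrow>
    equivariant G (obj_gset X) (obj_gset Y) (fst \<phi>) \<and>
    equivariant G (arr_gset X) (arr_gset Y) (snd \<phi>) \<and>
    (\<forall>p\<in>Arr X. Src Y (snd \<phi> p) = fst \<phi> (Src X p) \<and> Trg Y (snd \<phi> p) = fst \<phi> (Trg X p)) \<and>
    (\<forall>x\<in>Obj X. snd \<phi> (Ide X x) = Ide Y (fst \<phi> x)) \<and>
    (\<forall>p\<in>Arr X. \<forall>q\<in>Arr X. Src X p = Trg X q \<longrightarrow>
      snd \<phi> (Cmp X p q) = Cmp Y (snd \<phi> p) (snd \<phi> q))"

definition functor_id :: "('x \<Rightarrow> 'x) \<times> ('y \<Rightarrow> 'y)" where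
  "functor_id = (id, id)"

definition functor_comp ::
  "('u \<Rightarrow> 'w) \<times> ('v \<Rightarrow> 'z) \<Rightarrow> ('x \<Rightarrow> 'u) \<times> ('y \<Rightarrow> 'v) \<Rightarrow> ('x \<Rightarrow> 'w) \<times> ('y \<Rightarrow> 'z)" where
  "functor_comp \<psi> \<phi> = (fst \<psi> \<circ> fst \<phi>, snd \<psi> \<circ> snd \<phi>)"

definition internal_nat_trans ::
  "('o, 'g) small_cat \<Rightarrow> ('x, 'y, 'o, 'g) cgset \<Rightarrow> ('u, 'v, 'o, 'g) cgset \<Rightarrow>
    ('x \<Rightarrow> 'u) \<times> ('y \<Rightarrow> 'v) \<Rightarrow> ('x \<Rightarrow> 'u) \<times> ('y \<Rightarrow> 'v) \<Rightarrow> ('x \<Rightarrow> 'v) \<Rightarrow> bool" where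
  "internal_nat_trans G X Y \<phi> \<psi> \<eta> \<longleftrightarrow>
    equivariant G (obj_gset X) (arr_gset Y) \<eta> \<and>
    (\<forall>x\<in>Obj X. Src Y (\<eta> x) = fst \<phi> x \<and> Trg Y (\<eta> x) = fst \<psi> x) \<and>
    (\<forall>p\<in>Arr X. Cmp Y (snd \<psi> p) (\<eta> (Src X p)) = Cmp Y (\<eta> (Trg X p)) (snd \<phi> p))"

definition invertible_nat_trans ::
  "('o, 'g) small_cat \<Rightarrow> ('x, 'y, 'o, 'g) cgset \<Rightarrow> ('u, 'v, 'o, 'g) cgset \<Rightarrow>
    ('x \<Rightarrow> 'u) \<times> ('y \<Rightarrow> 'v) \<Rightarrow> ('x \<Rightarrow> 'u) \<times> ('y \<Rightarrow> 'v) \<Rightarrow> ('x \<Rightarrow> 'v) \<Rightarrow> bool" where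
  "invertible_nat_trans G X Y \<phi> \<psi> \<eta> \<longleftrightarrow>
    internal_nat_trans G X Y \<phi> \<psi> \<eta> \<and>
    (\<exists>\<theta>. internal_nat_trans G X Y \<psi> \<phi> \<theta> \<and>
      (\<forall>x\<in>Obj X. Cmp Y (\<theta> x) (\<eta> x) = Ide Y (fst \<phi> x) \<and> Cmp Y (\<eta> x) (\<theta> x) = Ide Y (fst \<psi> x)))"

definition weakly_equivalent ::
  "('o, 'g) small_cat \<Rightarrow> ('x, 'y, 'o, 'g) cgset \<Rightarrow> ('u, 'v, 'o, 'g) cgset \<Rightarrow> bool" where
  "weakly_equivalent G X Y \<longleftrightarrow>
    (\<exists>\<phi> \<psi>. internal_functor G X Y \<phi> \<and> internal_functor G Y X \<psi> \<and>
      (\<exists>\<eta>. invertible_nat_trans G X X (functor_comp \<psi> \<phi>) functor_id \<eta>) \<and>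
      (\<exists>\<theta>. invertible_nat_trans G Y Y (functor_comp \<phi> \<psi>) functor_id \<theta>))"


section \<open>Operations on categorified sets\<close>

definition cgset_empty :: "('x, 'y, 'o, 'g) cgset" where
  "cgset_empty =
    \<lparr>Obj = {}, Arr = {}, Src = undefined, Trg = undefined, Ide = undefined, Cmp = undefined,
     ObjStr = undefined, ObjAct = undefined, ArrStr = undefined, ArrAct = undefined\<rparr>"

text \<open>The second case of \<open>Cmp\<close> below only serves to make the function total: composable arrows lie
  in the same summand.\<close>

definition cgset_sum ::
  "('x, 'y, 'o, 'g) cgset \<Rightarrow> ('u, 'v, 'o, 'g) cgset \<Rightarrow> ('x + 'u, 'y + 'v, 'o, 'g) cgset" where
  "cgset_sum X Y =
    \<lparr>Obj = Sum_Type.Plus (Obj X) (Obj Y),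
     Arr = Sum_Type.Plus (Arr X) (Arr Y),
     Src = map_sum (Src X) (Src Y),
     Trg = map_sum (Trg X) (Trg Y),
     Ide = map_sum (Ide X) (Ide Y),
     Cmp = (\<lambda>p q. case (p, q) of
       (Inl p', Inl q') \<Rightarrow> Inl (Cmp X p' q')
     | (Inr p', Inr q') \<Rightarrow> Inr (Cmp Y p' q')
     | _ \<Rightarrow> undefined),
     ObjStr = case_sum (ObjStr X) (ObjStr Y),
     ObjAct = (\<lambda>x g. map_sum (\<lambda>x'. ObjAct X x' g) (\<lambda>x'. ObjAct Y x' g) x),
     ArrStr = case_sum (ArrStr X) (ArrStr Y),
     ArrAct = (\<lambda>p g. map_sum (\<lambda>p'. ArrAct X p' g) (\<lambda>p'. ArrAct Y p' g) p)\<rparr>"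

definition cgset_fibre_prod ::
  "('x, 'y, 'o, 'g) cgset \<Rightarrow> ('u, 'v, 'o, 'g) cgset \<Rightarrow> ('x \<times> 'u, 'y \<times> 'v, 'o, 'g) cgset" where
  "cgset_fibre_prod X Y =
    \<lparr>Obj = {(x, u). x \<in> Obj X \<and> u \<in> Obj Y \<and> ObjStr X x = ObjStr Y u},
     Arr = {(p, q). p \<in> Arr X \<and> q \<in> Arr Y \<and> ArrStr X p = ArrStr Y q},
     Src = map_prod (Src X) (Src Y),
     Trg = map_prod (Trg X) (Trg Y),
     Ide = map_prod (Ide X) (Ide Y),
     Cmp = (\<lambda>(p, q) (p', q'). (Cmp X p p', Cmp Y q q')),
     ObjStr = (\<lambda>(x, u). ObjStr X x),
     ObjAct = (\<lambda>(x, u) g. (ObjAct X x g, ObjAct Y u g)),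
     ArrStr = (\<lambda>(p, q). ArrStr X p),
     ArrAct = (\<lambda>(p, q) g. (ArrAct X p g, ArrAct Y q g))\<rparr>"

text \<open>The right \<open>G\<close>-set of objects of \<open>G\<close>, with \<open>t(g) \<cdot> g = s(g)\<close>, as a discrete category.\<close>

definition cgset_unit :: "('o, 'g) small_cat \<Rightarrow> ('o, 'o, 'o, 'g) cgset" where
  "cgset_unit G =
    \<lparr>Obj = Obj G, Arr = Obj G, Src = id, Trg = id, Ide = id, Cmp = (\<lambda>a b. a),
     ObjStr = id, ObjAct = (\<lambda>a g. Src G g), ArrStr = id, ArrAct = (\<lambda>a g. Src G g)\<rparr>"


section \<open>The categorified Burnside rig\<close>

text \<open>Every finite categorified \<open>G\<close>-set is isomorphic to one whose objects and arrows are natural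
  numbers. The weak equivalence class of \<open>X\<close>, whose objects and arrows may come from any types, is
  therefore represented by the set of all finite categorified \<open>G\<close>-sets over \<^typ>\<open>nat\<close> that are weakly
  equivalent to \<open>X\<close>.\<close>

definition weq_class ::
  "('o, 'g) small_cat \<Rightarrow> ('x, 'y, 'o, 'g) cgset \<Rightarrow> (nat, nat, 'o, 'g) cgset set" where
  "weq_class G X = {Y. finite_cgset G Y \<and> weakly_equivalent G X Y}"

text \<open>Rigs are represented by the record type \<^typ>\<open>'a ring\<close> of rings. The sums and products of two
  classes are written as unions over representatives; as both operations respect weak equivalence,
  these are unions of copies of a single class. The class of the unit is an element of the carrier
  only if \<open>Obj G\<close> is finite.\<close>

definition burnside_rig :: "('o, 'g) small_cat \<Rightarrow> (nat, nat, 'o, 'g) cgset set ring" where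
  "burnside_rig G =
    \<lparr>carrier = weq_class G ` {X :: (nat, nat, 'o, 'g) cgset. finite_cgset G X},
     mult = (\<lambda>A B. \<Union>X\<in>A. \<Union>Y\<in>B. weq_class G (cgset_fibre_prod X Y)),
     one = weq_class G (cgset_unit G),
     zero = weq_class G (cgset_empty :: (nat, nat, 'o, 'g) cgset),
     add = (\<lambda>A B. \<Union>X\<in>A. \<Union>Y\<in>B. weq_class G (cgset_sum X Y))\<rparr>"


section \<open>Grothendieck ring and products of rings\<close>

definition grothendieck_rel :: "('a, 'm) ring_scheme \<Rightarrow> (('a \<times> 'a) \<times> ('a \<times> 'a)) set" where
  "grothendieck_rel R =
    {((x, y), (x', y')). x \<in> carrier R \<and> y \<in> carrier R \<and> x' \<in> carrier R \<and> y' \<in> carrier R \<and>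
      (\<exists>e\<in>carrier R. x \<oplus>\<^bsub>R\<^esub> y' \<oplus>\<^bsub>R\<^esub> e = x' \<oplus>\<^bsub>R\<^esub> y \<oplus>\<^bsub>R\<^esub> e)}"

text \<open>\<open>grothendieck_class R (x, y)\<close> is the class \<open>[x, y]\<close>, the formal difference of \<open>x\<close> and \<open>y\<close>.\<close>

definition grothendieck_class :: "('a, 'm) ring_scheme \<Rightarrow> 'a \<times> 'a \<Rightarrow> ('a \<times> 'a) set" where
  "grothendieck_class R p = grothendieck_rel R `` {p}"

definition grothendieck_ring :: "('a, 'm) ring_scheme \<Rightarrow> ('a \<times> 'a) set ring" where
  "grothendieck_ring R =
    \<lparr>carrier = (carrier R \<times> carrier R) // grothendieck_rel R,
     mult = (\<lambda>A B. \<Union>(x, y)\<in>A. \<Union>(u, v)\<in>B.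
       grothendieck_class R (x \<otimes>\<^bsub>R\<^esub> u \<oplus>\<^bsub>R\<^esub> y \<otimes>\<^bsub>R\<^esub> v, x \<otimes>\<^bsub>R\<^esub> v \<oplus>\<^bsub>R\<^esub> y \<otimes>\<^bsub>R\<^esub> u)),
     one = grothendieck_class R (\<one>\<^bsub>R\<^esub>, \<zero>\<^bsub>R\<^esub>),
     zero = grothendieck_class R (\<zero>\<^bsub>R\<^esub>, \<zero>\<^bsub>R\<^esub>),
     add = (\<lambda>A B. \<Union>(x, y)\<in>A. \<Union>(u, v)\<in>B. grothendieck_class R (x \<oplus>\<^bsub>R\<^esub> u, y \<oplus>\<^bsub>R\<^esub> v))\<rparr>"

definition burnside_ring ::
  "('o, 'g) small_cat \<Rightarrow> ((nat, nat, 'o, 'g) cgset set \<times> (nat, nat, 'o, 'g) cgset set) set ring" where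
  "burnside_ring G = grothendieck_ring (burnside_rig G)"

definition product_ring :: "'i set \<Rightarrow> ('i \<Rightarrow> ('a, 'm) ring_scheme) \<Rightarrow> ('i \<Rightarrow> 'a) ring" where
  "product_ring I R =
    \<lparr>carrier = (\<Pi>\<^sub>E i\<in>I. carrier (R i)),
     mult = (\<lambda>x y. \<lambda>i\<in>I. x i \<otimes>\<^bsub>R i\<^esub> y i),
     one = (\<lambda>i\<in>I. \<one>\<^bsub>R i\<^esub>),
     zero = (\<lambda>i\<in>I. \<zero>\<^bsub>R i\<^esub>),
     add = (\<lambda>x y. \<lambda>i\<in>I. x i \<oplus>\<^bsub>R i\<^esub> y i)\<rparr>"

end

theory Submission
  imports Defs
begin

text \<open>
  Sending \<open>X\<close> to its fibre over an object \<open>a\<close> turns categorified \<open>G\<close>-sets into categorified sets over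
  the isotropy group at \<open>a\<close> and commutes strictly with sums, fibre products and units. If \<open>R\<close> meets
  every component of \<open>G\<close> once, choose an arrow \<open>\<tau> b\<close> from the representative \<open>\<rho> b\<close> to each object \<open>b\<close>.
  Translating along these arrows, an equivariant map is determined by, and can be prescribed
  arbitrarily on, the fibres over \<open>R\<close>; the same then holds for functors, natural transformations and
  weak equivalences, so a weak equivalence class is determined by its fibres over \<open>R\<close>. Conversely
  every family of fibres occurs: place a copy of the fibre at \<open>\<rho> b\<close> over each \<open>b\<close>, which stays finite
  because \<open>G\<close> has finitely many objects. Hence the Burnside rig is the product of those of the
  isotropy groups, and the Grothendieck construction commutes with products of rigs.
\<close>

section \<open>Functors and weak equivalences\<close>

text \<open>The isomorphism only takes fibres and depends on \<open>R\<close> alone; the arrows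
  \<open>\<tau> b\<close> enter in showing that it is bijective. Three obstacles shape the proof. An
  arrow \<open>g\<close> between arbitrary objects is not a loop at a representative, while
  prescribed data are equivariant only for such loops. Conjugating with the chosen arrows turns
  \<open>g\<close> into a loop \<open>\<kappa> g\<close>; this drives the extension of maps, and the
  same \<open>\<kappa>\<close> defines the action on the category assembled from a family of fibres.
  Secondly, rigs have neither negatives nor cancellation: equality of formal differences carries an
  auxiliary summand, which for a product must be assembled from one summand per factor, and
  preservation of zero does not follow from additivity. Thirdly, classes consist of categorified
  sets over \<open>nat\<close>, whereas sums, products and assembled categories live over other
  types, so everything is first brought back to \<open>nat\<close> along injections. Finiteness of
  \<open>Obj G\<close> also makes the unit a finite categorified set.\<close>

lemmas gset_defs = right_gset_def equivariant_def obj_gset_def arr_gset_def composable_gset_def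

locale cgset =
  fixes G :: "('o, 'g) small_cat" and X :: "('x, 'y, 'o, 'g) cgset"
  assumes categorified: "categorified_gset G X"
begin

sublocale small_category X
  using categorified by (simp add: categorified_gset_def)

lemma obj_right_gset: "right_gset G (obj_gset X)"
  and arr_right_gset: "right_gset G (arr_gset X)"
  using categorified by (simp_all add: categorified_gset_def)

lemma ObjStr_closed: "x \<in> Obj X \<Longrightarrow> ObjStr X x \<in> Obj G"
  and ObjAct_closed: "\<lbrakk>x \<in> Obj X; g \<in> Arr G; ObjStr X x = Trg G g\<rbrakk> \<Longrightarrow> ObjAct X x g \<in> Obj X"
  and ObjStr_Act: "\<lbrakk>x \<in> Obj X; g \<in> Arr G; ObjStr X x = Trg G g\<rbrakk> \<Longrightarrow> ObjStr X (ObjAct X x g) = Src G g"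
  and ObjAct_Ide: "x \<in> Obj X \<Longrightarrow> ObjAct X x (Ide G (ObjStr X x)) = x"
  and ObjAct_Cmp: "\<lbrakk>x \<in> Obj X; g \<in> Arr G; h \<in> Arr G; ObjStr X x = Trg G g; Src G g = Trg G h\<rbrakk>
    \<Longrightarrow> ObjAct X (ObjAct X x g) h = ObjAct X x (Cmp G g h)"
  using obj_right_gset by (simp_all add: gset_defs)

lemma ArrStr_closed: "p \<in> Arr X \<Longrightarrow> ArrStr X p \<in> Obj G"
  and ArrAct_closed: "\<lbrakk>p \<in> Arr X; g \<in> Arr G; ArrStr X p = Trg G g\<rbrakk> \<Longrightarrow> ArrAct X p g \<in> Arr X"
  and ArrStr_Act: "\<lbrakk>p \<in> Arr X; g \<in> Arr G; ArrStr X p = Trg G g\<rbrakk> \<Longrightarrow> ArrStr X (ArrAct X p g) = Src G g"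
  and ArrAct_Ide: "p \<in> Arr X \<Longrightarrow> ArrAct X p (Ide G (ArrStr X p)) = p"
  and ArrAct_Cmp: "\<lbrakk>p \<in> Arr X; g \<in> Arr G; h \<in> Arr G; ArrStr X p = Trg G g; Src G g = Trg G h\<rbrakk>
    \<Longrightarrow> ArrAct X (ArrAct X p g) h = ArrAct X p (Cmp G g h)"
  using arr_right_gset by (simp_all add: gset_defs)

lemma ObjStr_Src: "p \<in> Arr X \<Longrightarrow> ObjStr X (Src X p) = ArrStr X p"
  and ObjStr_Trg: "p \<in> Arr X \<Longrightarrow> ObjStr X (Trg X p) = ArrStr X p"
  and ArrStr_Ide: "x \<in> Obj X \<Longrightarrow> ArrStr X (Ide X x) = ObjStr X x"
  and ArrStr_Cmp: "\<lbrakk>p \<in> Arr X; q \<in> Arr X; Src X p = Trg X q\<rbrakk> \<Longrightarrow> ArrStr X (Cmp X p q) = ArrStr X p"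
  and Src_Act: "\<lbrakk>p \<in> Arr X; g \<in> Arr G; ArrStr X p = Trg G g\<rbrakk> \<Longrightarrow> Src X (ArrAct X p g) = ObjAct X (Src X p) g"
  and Trg_Act: "\<lbrakk>p \<in> Arr X; g \<in> Arr G; ArrStr X p = Trg G g\<rbrakk> \<Longrightarrow> Trg X (ArrAct X p g) = ObjAct X (Trg X p) g"
  and Ide_Act: "\<lbrakk>x \<in> Obj X; g \<in> Arr G; ObjStr X x = Trg G g\<rbrakk> \<Longrightarrow> Ide X (ObjAct X x g) = ArrAct X (Ide X x) g"
  and Cmp_Act: "\<lbrakk>p \<in> Arr X; q \<in> Arr X; Src X p = Trg X q; g \<in> Arr G; ArrStr X p = Trg G g\<rbrakk>
    \<Longrightarrow> Cmp X (ArrAct X p g) (ArrAct X q g) = ArrAct X (Cmp X p q) g"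
  using categorified by (auto simp: categorified_gset_def gset_defs)

text \<open>An arrow lies in the same fibre as both of its ends, so the shared object forces equal
  structure values. Hence reading the structure map of \<open>composable_gset\<close> off the first
  component loses nothing.\<close>

lemma ArrStr_composable: "\<lbrakk>p \<in> Arr X; q \<in> Arr X; Src X p = Trg X q\<rbrakk> \<Longrightarrow> ArrStr X q = ArrStr X p"
  by (metis ObjStr_Src ObjStr_Trg)

lemmas cgset_facts [simp] =
  Src_closed Trg_closed Ide_closed Src_Ide Trg_Ide Cmp_closed Src_Cmp Trg_Cmp
  Cmp_Ide_left Cmp_Ide_right
  ObjStr_closed ObjAct_closed ObjStr_Act ObjAct_Ide ObjAct_Cmp
  ArrStr_closed ArrAct_closed ArrStr_Act ArrAct_Ide ArrAct_Cmp
  ObjStr_Src ObjStr_Trg ArrStr_Ide ArrStr_Cmp Src_Act Trg_Act Ide_Act Cmp_Act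

lemma inj_Ide: "inj_on (Ide X) (Obj X)"
  by (metis inj_onI Src_Ide)

text \<open>Identities embed the objects into the arrows, so a finiteness condition on arrows alone
  also lets the objects be numbered.\<close>

lemma finite_Obj: "finite (Arr X) \<Longrightarrow> finite (Obj X)"
  by (rule inj_on_finite[OF inj_Ide]) auto

end

locale cgset_functor = X: cgset G X + Y: cgset G Y
  for G :: "('o, 'g) small_cat" and X :: "('x, 'y, 'o, 'g) cgset" and Y :: "('u, 'v, 'o, 'g) cgset" +
  fixes \<phi> :: "('x \<Rightarrow> 'u) \<times> ('y \<Rightarrow> 'v)"
  assumes functorial: "internal_functor G X Y \<phi>"
begin

lemma functor_facts [simp]:
  "x \<in> Obj X \<Longrightarrow> fst \<phi> x \<in> Obj Y"
  "x \<in> Obj X \<Longrightarrow> ObjStr Y (fst \<phi> x) = ObjStr X x"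
  "\<lbrakk>x \<in> Obj X; g \<in> Arr G; ObjStr X x = Trg G g\<rbrakk> \<Longrightarrow> fst \<phi> (ObjAct X x g) = ObjAct Y (fst \<phi> x) g"
  "p \<in> Arr X \<Longrightarrow> snd \<phi> p \<in> Arr Y"
  "p \<in> Arr X \<Longrightarrow> ArrStr Y (snd \<phi> p) = ArrStr X p"
  "\<lbrakk>p \<in> Arr X; g \<in> Arr G; ArrStr X p = Trg G g\<rbrakk> \<Longrightarrow> snd \<phi> (ArrAct X p g) = ArrAct Y (snd \<phi> p) g"
  "p \<in> Arr X \<Longrightarrow> Src Y (snd \<phi> p) = fst \<phi> (Src X p)"
  "p \<in> Arr X \<Longrightarrow> Trg Y (snd \<phi> p) = fst \<phi> (Trg X p)"
  "x \<in> Obj X \<Longrightarrow> snd \<phi> (Ide X x) = Ide Y (fst \<phi> x)"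
  "\<lbrakk>p \<in> Arr X; q \<in> Arr X; Src X p = Trg X q\<rbrakk> \<Longrightarrow> snd \<phi> (Cmp X p q) = Cmp Y (snd \<phi> p) (snd \<phi> q)"
  using functorial by (auto simp: internal_functor_def gset_defs)

end

lemma internal_functor_id: "internal_functor G X X functor_id"
  by (simp add: internal_functor_def functor_id_def gset_defs)

lemma internal_functor_comp:
  assumes "internal_functor G X Y \<phi>" "internal_functor G Y Z \<psi>"
    and "categorified_gset G X"
  shows "internal_functor G X Z (functor_comp \<psi> \<phi>)"
proof -
  interpret cgset G X using assms by unfold_locales
  show ?thesis using assms(1,2)
    by (simp add: internal_functor_def functor_comp_def gset_defs)
qed

section \<open>Natural transformations: vertical composition, whiskering, invertibility\<close>

lemma nat_trans_facts:
  assumes "internal_nat_trans G X Y \<phi> \<psi> \<eta>"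
  shows "x \<in> Obj X \<Longrightarrow> \<eta> x \<in> Arr Y"
    "x \<in> Obj X \<Longrightarrow> ArrStr Y (\<eta> x) = ObjStr X x"
    "\<lbrakk>x \<in> Obj X; g \<in> Arr G; ObjStr X x = Trg G g\<rbrakk> \<Longrightarrow> \<eta> (ObjAct X x g) = ArrAct Y (\<eta> x) g"
    "x \<in> Obj X \<Longrightarrow> Src Y (\<eta> x) = fst \<phi> x"
    "x \<in> Obj X \<Longrightarrow> Trg Y (\<eta> x) = fst \<psi> x"
    "p \<in> Arr X \<Longrightarrow> Cmp Y (snd \<psi> p) (\<eta> (Src X p)) = Cmp Y (\<eta> (Trg X p)) (snd \<phi> p)"
  using assms by (auto simp: internal_nat_trans_def gset_defs)

lemma nat_trans_comp:
  assumes "categorified_gset G X" "categorified_gset G Y"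
    and "internal_functor G X Y \<phi>" "internal_functor G X Y \<psi>" "internal_functor G X Y \<chi>"
    and "internal_nat_trans G X Y \<phi> \<psi> \<eta>" "internal_nat_trans G X Y \<psi> \<chi> \<theta>"
  shows "internal_nat_trans G X Y \<phi> \<chi> (\<lambda>x. Cmp Y (\<theta> x) (\<eta> x))"
proof -
  interpret \<phi>: cgset_functor G X Y \<phi> using assms by unfold_locales
  interpret \<psi>: cgset_functor G X Y \<psi> using assms by unfold_locales
  interpret \<chi>: cgset_functor G X Y \<chi> using assms by unfold_locales
  note * [simp] = nat_trans_facts[OF assms(6)] nat_trans_facts[OF assms(7)]
  have "Cmp Y (snd \<chi> p) (Cmp Y (\<theta> (Src X p)) (\<eta> (Src X p)))
      = Cmp Y (Cmp Y (\<theta> (Trg X p)) (\<eta> (Trg X p))) (snd \<phi> p)" if p: "p \<in> Arr X" for p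
  proof -
    \<comment> \<open>Two naturality squares are pasted: that of \<open>\<theta>\<close> turns
      \<open>snd \<chi> p\<close> into \<open>snd \<psi> p\<close>, that of \<open>\<eta>\<close>
      turns \<open>snd \<psi> p\<close> into \<open>snd \<phi> p\<close>.\<close>
    have "Cmp Y (snd \<chi> p) (Cmp Y (\<theta> (Src X p)) (\<eta> (Src X p)))
      = Cmp Y (Cmp Y (\<theta> (Trg X p)) (snd \<psi> p)) (\<eta> (Src X p))"
      using p by (simp flip: \<phi>.Y.Cmp_assoc *(6,12))
    also have "\<dots> = Cmp Y (\<theta> (Trg X p)) (Cmp Y (\<eta> (Trg X p)) (snd \<phi> p))"
      using p by (simp add: \<phi>.Y.Cmp_assoc)
    finally show ?thesis using p by (simp add: \<phi>.Y.Cmp_assoc)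
  qed
  then show ?thesis
    by (simp add: internal_nat_trans_def gset_defs)
qed

lemma nat_trans_whisker_left:
  assumes "categorified_gset G X" "categorified_gset G Y" "categorified_gset G Z"
    and "internal_functor G X Y \<phi>" "internal_functor G X Y \<psi>" "internal_functor G Y Z F"
    and "internal_nat_trans G X Y \<phi> \<psi> \<eta>"
  shows "internal_nat_trans G X Z (functor_comp F \<phi>) (functor_comp F \<psi>) (\<lambda>x. snd F (\<eta> x))"
proof -
  interpret \<phi>: cgset_functor G X Y \<phi> using assms by unfold_locales
  interpret \<psi>: cgset_functor G X Y \<psi> using assms by unfold_locales
  interpret F: cgset_functor G Y Z F using assms by unfold_locales
  note [simp] = nat_trans_facts[OF assms(7)]
  show ?thesis
    by (simp add: internal_nat_trans_def gset_defs functor_comp_def flip: F.functor_facts(10))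
qed

lemma nat_trans_whisker_right:
  assumes "categorified_gset G W" "categorified_gset G X"
    and "internal_functor G W X F" "internal_nat_trans G X Y \<phi> \<psi> \<eta>"
  shows "internal_nat_trans G W Y (functor_comp \<phi> F) (functor_comp \<psi> F) (\<lambda>w. \<eta> (fst F w))"
proof -
  interpret F: cgset_functor G W X F using assms by unfold_locales
  note * [simp] = nat_trans_facts[OF assms(4)]
  have "Cmp Y (snd \<psi> (snd F p)) (\<eta> (fst F (Src W p))) = Cmp Y (\<eta> (fst F (Trg W p))) (snd \<phi> (snd F p))"
    if "p \<in> Arr W" for p
    using *(6)[of "snd F p"] that by simp
  then show ?thesis
    by (simp add: internal_nat_trans_def gset_defs functor_comp_def)
qed

lemma invertible_nat_trans_comp:
  assumes "categorified_gset G X" "categorified_gset G Y"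
    and "internal_functor G X Y \<phi>" "internal_functor G X Y \<psi>" "internal_functor G X Y \<chi>"
    and "invertible_nat_trans G X Y \<phi> \<psi> \<eta>" "invertible_nat_trans G X Y \<psi> \<chi> \<theta>"
  shows "invertible_nat_trans G X Y \<phi> \<chi> (\<lambda>x. Cmp Y (\<theta> x) (\<eta> x))"
proof -
  interpret \<phi>: cgset_functor G X Y \<phi> using assms by unfold_locales
  obtain \<eta>' where \<eta>: "internal_nat_trans G X Y \<phi> \<psi> \<eta>" "internal_nat_trans G X Y \<psi> \<phi> \<eta>'"
    "\<And>x. x \<in> Obj X \<Longrightarrow> Cmp Y (\<eta>' x) (\<eta> x) = Ide Y (fst \<phi> x) \<and> Cmp Y (\<eta> x) (\<eta>' x) = Ide Y (fst \<psi> x)"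
    using assms(6) by (auto simp: invertible_nat_trans_def)
  obtain \<theta>' where \<theta>: "internal_nat_trans G X Y \<psi> \<chi> \<theta>" "internal_nat_trans G X Y \<chi> \<psi> \<theta>'"
    "\<And>x. x \<in> Obj X \<Longrightarrow> Cmp Y (\<theta>' x) (\<theta> x) = Ide Y (fst \<psi> x) \<and> Cmp Y (\<theta> x) (\<theta>' x) = Ide Y (fst \<chi> x)"
    using assms(7) by (auto simp: invertible_nat_trans_def)
  note [simp] = nat_trans_facts[OF \<eta>(1)] nat_trans_facts[OF \<eta>(2)]
    nat_trans_facts[OF \<theta>(1)] nat_trans_facts[OF \<theta>(2)]
  \<comment> \<open>In a composite of four arrows an inner inverse pair cancels. Both inverse laws
    have this shape, with \<open>\<theta>'\<close>, \<open>\<theta>\<close> in the middle for one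
    and \<open>\<eta>\<close>, \<open>\<eta>'\<close> for the other.\<close>
  have cancel: "Cmp Y (Cmp Y a b) (Cmp Y c d) = Cmp Y a d"
    if "a \<in> Arr Y" "b \<in> Arr Y" "c \<in> Arr Y" "d \<in> Arr Y" "Src Y a = Trg Y b" "Src Y b = Trg Y c"
      "Src Y c = Trg Y d" "Cmp Y b c = Ide Y (Trg Y d)" for a b c d
  proof -
    have "Cmp Y (Cmp Y b c) d = Cmp Y b (Cmp Y c d)"
      using that by (intro \<phi>.Y.Cmp_assoc)
    with that show ?thesis by (simp add: \<phi>.Y.Cmp_assoc)
  qed
  have "internal_nat_trans G X Y \<chi> \<phi> (\<lambda>x. Cmp Y (\<eta>' x) (\<theta>' x))"
    using nat_trans_comp assms(1-5) \<eta> \<theta> by blast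
  moreover have "Cmp Y (Cmp Y (\<eta>' x) (\<theta>' x)) (Cmp Y (\<theta> x) (\<eta> x)) = Ide Y (fst \<phi> x)"
    "Cmp Y (Cmp Y (\<theta> x) (\<eta> x)) (Cmp Y (\<eta>' x) (\<theta>' x)) = Ide Y (fst \<chi> x)" if "x \<in> Obj X" for x
    using that \<eta>(3) \<theta>(3) by (simp_all add: cancel)
  ultimately show ?thesis
    using nat_trans_comp[OF assms(1-5) \<eta>(1) \<theta>(1)] unfolding invertible_nat_trans_def by blast
qed

text \<open>A functor preserves composites and identities, so it carries inverse components to
  inverse components. Whiskering on both sides at once is the form used for composing weak
  equivalences.\<close>

lemma invertible_whisker:
  assumes "categorified_gset G W" "categorified_gset G X" "categorified_gset G Y" "categorified_gset G Z"
    and "internal_functor G W X E" "internal_functor G Y Z F"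
    and "internal_functor G X Y \<phi>" "internal_functor G X Y \<psi>"
    and "invertible_nat_trans G X Y \<phi> \<psi> \<eta>"
  shows "invertible_nat_trans G W Z (functor_comp F (functor_comp \<phi> E)) (functor_comp F (functor_comp \<psi> E))
    (\<lambda>w. snd F (\<eta> (fst E w)))"
proof -
  interpret E: cgset_functor G W X E using assms by unfold_locales
  interpret F: cgset_functor G Y Z F using assms by unfold_locales
  obtain \<eta>' where \<eta>: "internal_nat_trans G X Y \<phi> \<psi> \<eta>" "internal_nat_trans G X Y \<psi> \<phi> \<eta>'"
    and inv: "\<And>x. x \<in> Obj X \<Longrightarrow> Cmp Y (\<eta>' x) (\<eta> x) = Ide Y (fst \<phi> x) \<and> Cmp Y (\<eta> x) (\<eta>' x) = Ide Y (fst \<psi> x)"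
    using assms(9) by (auto simp: invertible_nat_trans_def)
  have W: "internal_functor G W Y (functor_comp \<phi> E)" "internal_functor G W Y (functor_comp \<psi> E)"
    using assms by (auto intro: internal_functor_comp)
  note N = nat_trans_whisker_left[OF assms(1,3,4) _ _ assms(6) nat_trans_whisker_right[OF assms(1,2,5)]]
  interpret \<phi>: cgset_functor G X Y \<phi> using assms by unfold_locales
  interpret \<psi>: cgset_functor G X Y \<psi> using assms by unfold_locales
  note [simp] = nat_trans_facts[OF \<eta>(1)] nat_trans_facts[OF \<eta>(2)]
  show ?thesis unfolding invertible_nat_trans_def
  proof (intro conjI exI[of _ "\<lambda>w. snd F (\<eta>' (fst E w))"] ballI)
    fix w assume "w \<in> Obj W"
    then show "Cmp Z (snd F (\<eta>' (fst E w))) (snd F (\<eta> (fst E w))) = Ide Z (fst (functor_comp F (functor_comp \<phi> E)) w)"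
      "Cmp Z (snd F (\<eta> (fst E w))) (snd F (\<eta>' (fst E w))) = Ide Z (fst (functor_comp F (functor_comp \<psi> E)) w)"
      using inv by (simp_all flip: F.functor_facts(10) add: functor_comp_def)
  qed (use N W \<eta> in blast)+
qed

section \<open>Symmetry and transitivity of weak equivalence\<close>

lemma weakly_equivalent_sym: "weakly_equivalent G X Y \<Longrightarrow> weakly_equivalent G Y X"
  unfolding weakly_equivalent_def by blast

text \<open>Half of transitivity: between \<open>\<psi>\<close> and \<open>\<phi>\<close> the inner
  round trip contracts along \<open>\<eta>'\<close>, and the remaining round trip contracts along
  \<open>\<eta>\<close>. The other half is the same statement with the roles of \<open>X\<close> and
  \<open>Z\<close> exchanged.\<close>

lemma functor_comp_inverse_up_to_iso:
  assumes "categorified_gset G X" "categorified_gset G Y" "categorified_gset G Z"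
    and "internal_functor G X Y \<phi>" "internal_functor G Y X \<psi>"
    and "internal_functor G Y Z \<phi>'" "internal_functor G Z Y \<psi>'"
    and "invertible_nat_trans G X X (functor_comp \<psi> \<phi>) functor_id \<eta>"
    and "invertible_nat_trans G Y Y (functor_comp \<psi>' \<phi>') functor_id \<eta>'"
  shows "\<exists>\<theta>. invertible_nat_trans G X X (functor_comp (functor_comp \<psi> \<psi>') (functor_comp \<phi>' \<phi>)) functor_id \<theta>"
proof -
  have "invertible_nat_trans G X X (functor_comp \<psi> (functor_comp (functor_comp \<psi>' \<phi>') \<phi>))
     (functor_comp \<psi> (functor_comp functor_id \<phi>)) (\<lambda>w. snd \<psi> (\<eta>' (fst \<phi> w)))"
    using assms by (intro invertible_whisker) (auto intro: internal_functor_id internal_functor_comp)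
  \<comment> \<open>Pairs of functions compose strictly associatively and \<open>functor_id\<close>
    is strictly neutral, so this is mere rebracketing without coherence arrows.\<close>
  then have "invertible_nat_trans G X X (functor_comp (functor_comp \<psi> \<psi>') (functor_comp \<phi>' \<phi>))
     (functor_comp \<psi> \<phi>) (\<lambda>w. snd \<psi> (\<eta>' (fst \<phi> w)))"
    by (simp add: functor_comp_def functor_id_def o_assoc)
  moreover have "internal_functor G X X (functor_comp \<psi> \<phi>)"
    using internal_functor_comp assms(1,4,5) by blast
  moreover have "internal_functor G X X (functor_comp (functor_comp \<psi> \<psi>') (functor_comp \<phi>' \<phi>))"
    using internal_functor_comp[OF internal_functor_comp[OF assms(4,6,1)]
      internal_functor_comp[OF assms(7,5,3)] assms(1)] .
  ultimately show ?thesis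
    using invertible_nat_trans_comp[OF assms(1,1)] internal_functor_id assms(8) by blast
qed

lemma weakly_equivalent_trans:
  assumes XYZ: "categorified_gset G X" "categorified_gset G Y" "categorified_gset G Z"
    and "weakly_equivalent G X Y" "weakly_equivalent G Y Z"
  shows "weakly_equivalent G X Z"
proof -
  obtain \<phi> \<psi> \<eta> \<theta> where 1: "internal_functor G X Y \<phi>" "internal_functor G Y X \<psi>"
    "invertible_nat_trans G X X (functor_comp \<psi> \<phi>) functor_id \<eta>"
    "invertible_nat_trans G Y Y (functor_comp \<phi> \<psi>) functor_id \<theta>"
    using assms(4) unfolding weakly_equivalent_def by blast
  obtain \<phi>' \<psi>' \<eta>' \<theta>' where 2: "internal_functor G Y Z \<phi>'" "internal_functor G Z Y \<psi>'"
    "invertible_nat_trans G Y Y (functor_comp \<psi>' \<phi>') functor_id \<eta>'"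
    "invertible_nat_trans G Z Z (functor_comp \<phi>' \<psi>') functor_id \<theta>'"
    using assms(5) unfolding weakly_equivalent_def by blast
  show ?thesis unfolding weakly_equivalent_def
    using functor_comp_inverse_up_to_iso[OF XYZ 1(1,2) 2(1,2) 1(3) 2(3)] functor_comp_inverse_up_to_iso[OF XYZ(3,2,1) 2(2,1) 1(2,1) 2(4) 1(4)]
      internal_functor_comp[OF 1(1) 2(1)] internal_functor_comp[OF 2(2) 1(2)] XYZ by blast
qed

section \<open>Isomorphisms as weak equivalences\<close>

definition cgset_iso ::
  "('o, 'g) small_cat \<Rightarrow> ('x, 'y, 'o, 'g) cgset \<Rightarrow> ('u, 'v, 'o, 'g) cgset \<Rightarrow>
    ('x \<Rightarrow> 'u) \<times> ('y \<Rightarrow> 'v) \<Rightarrow> bool" where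
  "cgset_iso G X Y \<phi> \<longleftrightarrow> internal_functor G X Y \<phi> \<and>
    bij_betw (fst \<phi>) (Obj X) (Obj Y) \<and> bij_betw (snd \<phi>) (Arr X) (Arr Y)"

text \<open>Since functions are total, the round trip along an isomorphism equals
  \<open>functor_id\<close> only on the carriers. The identity arrows still form an invertible
  transformation between the two.\<close>

lemma invertible_nat_trans_Ide:
  assumes "categorified_gset G X" and "internal_functor G X X \<phi>"
    and "\<And>x. x \<in> Obj X \<Longrightarrow> fst \<phi> x = x" "\<And>p. p \<in> Arr X \<Longrightarrow> snd \<phi> p = p"
  shows "invertible_nat_trans G X X \<phi> functor_id (Ide X)"
proof -
  interpret cgset G X using assms by unfold_locales
  have "Cmp X (Ide X x) (Ide X x) = Ide X x" if "x \<in> Obj X" for x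
    by (metis Cmp_Ide_right Ide_closed Src_Ide that)
  then show ?thesis using assms(3,4)
    by (auto simp: invertible_nat_trans_def internal_nat_trans_def gset_defs functor_id_def intro!: exI[of _ "Ide X"])
qed

lemma weakly_equivalent_if_inverse:
  assumes "categorified_gset G X" "categorified_gset G Y"
    and "internal_functor G X Y \<phi>" "internal_functor G Y X \<psi>"
    and "\<And>x. x \<in> Obj X \<Longrightarrow> fst \<psi> (fst \<phi> x) = x" "\<And>p. p \<in> Arr X \<Longrightarrow> snd \<psi> (snd \<phi> p) = p"
    and "\<And>x. x \<in> Obj Y \<Longrightarrow> fst \<phi> (fst \<psi> x) = x" "\<And>p. p \<in> Arr Y \<Longrightarrow> snd \<phi> (snd \<psi> p) = p"
  shows "weakly_equivalent G X Y"
proof -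
  have "invertible_nat_trans G X X (functor_comp \<psi> \<phi>) functor_id (Ide X)"
    by (rule invertible_nat_trans_Ide[OF assms(1) internal_functor_comp[OF assms(3,4,1)]])
      (simp_all add: assms(5,6) functor_comp_def)
  moreover have "invertible_nat_trans G Y Y (functor_comp \<phi> \<psi>) functor_id (Ide Y)"
    by (rule invertible_nat_trans_Ide[OF assms(2) internal_functor_comp[OF assms(4,3,2)]])
      (simp_all add: assms(7,8) functor_comp_def)
  ultimately show ?thesis using assms(3,4) unfolding weakly_equivalent_def by blast
qed

text \<open>Every object and arrow of \<open>Y\<close> is an image under \<open>\<phi>\<close>, so
  each functor or equivariance law of the inverse is the corresponding law of \<open>\<phi>\<close>
  read backwards.\<close>

lemma cgset_iso_weakly_equivalent:
  assumes "categorified_gset G X" "categorified_gset G Y" "cgset_iso G X Y \<phi>"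
  shows "weakly_equivalent G X Y"
proof -
  interpret \<phi>: cgset_functor G X Y \<phi> using assms by unfold_locales (simp_all add: cgset_iso_def)
  define f where "f = inv_into (Obj X) (fst \<phi>)"
  define h where "h = inv_into (Arr X) (snd \<phi>)"
  have b: "bij_betw (fst \<phi>) (Obj X) (Obj Y)" "bij_betw (snd \<phi>) (Arr X) (Arr Y)"
    using assms(3) by (simp_all add: cgset_iso_def)
  have f: "f (fst \<phi> x) = x" if "x \<in> Obj X" for x
    using that b(1) by (simp add: f_def bij_betw_inv_into_left)
  have h: "h (snd \<phi> x) = x" if "x \<in> Arr X" for x
    using that b(2) by (simp add: h_def bij_betw_inv_into_left)
  have Obj: "Obj Y = fst \<phi> ` Obj X" and Arr: "Arr Y = snd \<phi> ` Arr X"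
    using b by (simp_all add: bij_betw_def)
  have inj: "fst \<phi> x = fst \<phi> y \<longleftrightarrow> x = y" if "x \<in> Obj X" "y \<in> Obj X" for x y
    by (metis f that)
  have "internal_functor G Y X (f, h)"
    by (auto simp: internal_functor_def gset_defs Obj Arr f h inj
        simp flip: \<phi>.functor_facts(3,6,9,10))
  then show ?thesis
    by (rule weakly_equivalent_if_inverse[OF assms(1,2) \<phi>.functorial]) (auto simp: f h Obj Arr)
qed

section \<open>The operations of the Burnside rig\<close>

text \<open>The injections merely rename: each operation decodes its arguments, computes in
  \<open>X\<close> and encodes the result. Numbering objects and arrows is the case used.\<close>

lemma finite_cgset_transport:
  fixes X :: "('x, 'y, 'o, 'g) cgset" and f :: "'x \<Rightarrow> 'u" and h :: "'y \<Rightarrow> 'v"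
  assumes "finite_cgset G X" and "inj_on f (Obj X)" "inj_on h (Arr X)"
  obtains Z where "finite_cgset G Z" "cgset_iso G X Z (f, h)"
proof
  interpret cgset G X using assms by unfold_locales (simp add: finite_cgset_def)
  define f' where "f' = inv_into (Obj X) f"
  define h' where "h' = inv_into (Arr X) h"
  have f' [simp]: "f' (f x) = x" if "x \<in> Obj X" for x
    using that assms(2) by (simp add: f'_def)
  have h' [simp]: "h' (h x) = x" if "x \<in> Arr X" for x
    using that assms(3) by (simp add: h'_def)
  have inj [simp]: "f x = f y \<longleftrightarrow> x = y" if "x \<in> Obj X" "y \<in> Obj X" for x y
    using that assms(2) by (simp add: inj_on_eq_iff)
  define Z :: "('u, 'v, 'o, 'g) cgset" where "Z =
    \<lparr>Obj = f ` Obj X, Arr = h ` Arr X, Src = \<lambda>p. f (Src X (h' p)), Trg = \<lambda>p. f (Trg X (h' p)),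
     Ide = \<lambda>x. h (Ide X (f' x)), Cmp = \<lambda>p q. h (Cmp X (h' p) (h' q)),
     ObjStr = \<lambda>x. ObjStr X (f' x), ObjAct = \<lambda>x g. f (ObjAct X (f' x) g),
     ArrStr = \<lambda>p. ArrStr X (h' p), ArrAct = \<lambda>p g. h (ArrAct X (h' p) g)\<rparr>"
  have "small_category Z"
    by unfold_locales (auto simp: Z_def Cmp_assoc)
  then have "categorified_gset G Z"
    by (auto simp: categorified_gset_def gset_defs Z_def ArrStr_composable)
  then show "finite_cgset G Z"
    using assms(1) by (simp add: finite_cgset_def Z_def)
  show "cgset_iso G X Z (f, h)"
    using assms(2,3) by (simp add: cgset_iso_def internal_functor_def gset_defs Z_def bij_betw_def)
qed

lemma finite_cgset_categorified: "finite_cgset G X \<Longrightarrow> categorified_gset G X"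
  by (simp add: finite_cgset_def)

lemma finite_cgset_nat_copy:
  assumes "finite_cgset G X"
  obtains Z :: "(nat, nat, 'o, 'g) cgset" where "finite_cgset G Z" "weakly_equivalent G X Z"
proof -
  interpret cgset G X using assms by unfold_locales (simp add: finite_cgset_def)
  have fin: "finite (Arr X)" using assms by (simp add: finite_cgset_def)
  obtain f :: "'a \<Rightarrow> nat" where f: "inj_on f (Obj X)"
    using finite_imp_inj_to_nat_seg[OF finite_Obj[OF fin]] by blast
  obtain h :: "'b \<Rightarrow> nat" where h: "inj_on h (Arr X)"
    using finite_imp_inj_to_nat_seg[OF fin] by blast
  obtain Z where "finite_cgset G Z" "cgset_iso G X Z (f, h)"
    using finite_cgset_transport[OF assms f h] .
  with that show ?thesis
    using cgset_iso_weakly_equivalent assms finite_cgset_categorified by metis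
qed

text \<open>\<open>X\<close> may have the wrong type to belong to its own class; a numbered copy of
  it is a member.\<close>

lemma weq_class_nonempty: "finite_cgset G X \<Longrightarrow> weq_class G X \<noteq> {}"
  by (erule finite_cgset_nat_copy) (auto simp: weq_class_def)

text \<open>The types of \<open>X\<close> and \<open>Y\<close> are arbitrary and may differ, so
  neither need lie in the common class. A member \<open>Z\<close> over \<open>nat\<close> serves as
  a bridge between them.\<close>

lemma weq_class_eq_iff:
  assumes "finite_cgset G X" "finite_cgset G Y"
  shows "weq_class G X = weq_class G Y \<longleftrightarrow> weakly_equivalent G X Y"
proof
  assume *: "weq_class G X = weq_class G Y"
  obtain Z where "Z \<in> weq_class G X"
    using weq_class_nonempty[OF assms(1)] by blast
  then have "weakly_equivalent G X Z" "weakly_equivalent G Z Y" "finite_cgset G Z"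
    using * by (auto simp: weq_class_def intro: weakly_equivalent_sym)
  then show "weakly_equivalent G X Y"
    using assms weakly_equivalent_trans[of G X Z Y] by (simp add: finite_cgset_def)
next
  assume XY: "weakly_equivalent G X Y"
  have "weakly_equivalent G X Z \<longleftrightarrow> weakly_equivalent G Y Z" if "finite_cgset G Z" for Z
    using XY weakly_equivalent_sym[OF XY] that assms weakly_equivalent_trans[of G X Y Z]
      weakly_equivalent_trans[of G Y X Z] by (auto simp: finite_cgset_def)
  then show "weq_class G X = weq_class G Y"
    unfolding weq_class_def by blast
qed

lemma weq_class_in_carrier:
  fixes G :: "('o, 'g) small_cat"
  assumes "finite_cgset G X"
  shows "weq_class G X \<in> carrier (burnside_rig G)"
proof -
  obtain Z :: "(nat, nat, 'o, 'g) cgset" where "finite_cgset G Z" "weakly_equivalent G X Z"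
    using finite_cgset_nat_copy[OF assms] .
  then have "weq_class G X = weq_class G Z"
    using assms weq_class_eq_iff by blast
  then show ?thesis
    using \<open>finite_cgset G Z\<close> by (simp add: burnside_rig_def)
qed

lemma burnside_rig_carrierE:
  fixes G :: "('o, 'g) small_cat"
  assumes "A \<in> carrier (burnside_rig G)"
  obtains X :: "(nat, nat, 'o, 'g) cgset" where "finite_cgset G X" "A = weq_class G X"
  using assms by (auto simp: burnside_rig_def)

section \<open>Sums, fibre products, zero and unit as finite categorified sets\<close>

lemma cgset_sum_simps [simp]:
  "Obj (cgset_sum X Y) = Sum_Type.Plus (Obj X) (Obj Y)"
  "Arr (cgset_sum X Y) = Sum_Type.Plus (Arr X) (Arr Y)"
  "Src (cgset_sum X Y) = map_sum (Src X) (Src Y)"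
  "Trg (cgset_sum X Y) = map_sum (Trg X) (Trg Y)"
  "Ide (cgset_sum X Y) = map_sum (Ide X) (Ide Y)"
  "Cmp (cgset_sum X Y) (Inl p) (Inl q) = Inl (Cmp X p q)"
  "Cmp (cgset_sum X Y) (Inr r) (Inr s) = Inr (Cmp Y r s)"
  "ObjStr (cgset_sum X Y) = case_sum (ObjStr X) (ObjStr Y)"
  "ObjAct (cgset_sum X Y) = (\<lambda>x g. map_sum (\<lambda>x'. ObjAct X x' g) (\<lambda>x'. ObjAct Y x' g) x)"
  "ArrStr (cgset_sum X Y) = case_sum (ArrStr X) (ArrStr Y)"
  "ArrAct (cgset_sum X Y) = (\<lambda>p g. map_sum (\<lambda>p'. ArrAct X p' g) (\<lambda>p'. ArrAct Y p' g) p)"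
  by (simp_all add: cgset_sum_def)

lemma cgset_fibre_prod_simps [simp]:
  "Obj (cgset_fibre_prod X Y) = {(x, u). x \<in> Obj X \<and> u \<in> Obj Y \<and> ObjStr X x = ObjStr Y u}"
  "Arr (cgset_fibre_prod X Y) = {(p, q). p \<in> Arr X \<and> q \<in> Arr Y \<and> ArrStr X p = ArrStr Y q}"
  "Src (cgset_fibre_prod X Y) = map_prod (Src X) (Src Y)"
  "Trg (cgset_fibre_prod X Y) = map_prod (Trg X) (Trg Y)"
  "Ide (cgset_fibre_prod X Y) = map_prod (Ide X) (Ide Y)"
  "Cmp (cgset_fibre_prod X Y) = (\<lambda>(p, q) (p', q'). (Cmp X p p', Cmp Y q q'))"
  "ObjStr (cgset_fibre_prod X Y) = (\<lambda>(x, u). ObjStr X x)"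
  "ObjAct (cgset_fibre_prod X Y) = (\<lambda>(x, u) g. (ObjAct X x g, ObjAct Y u g))"
  "ArrStr (cgset_fibre_prod X Y) = (\<lambda>(p, q). ArrStr X p)"
  "ArrAct (cgset_fibre_prod X Y) = (\<lambda>(p, q) g. (ArrAct X p g, ArrAct Y q g))"
  by (simp_all add: cgset_fibre_prod_def)

lemma finite_cgset_sum:
  assumes "finite_cgset G X" "finite_cgset G Y"
  shows "finite_cgset G (cgset_sum X Y)"
proof -
  interpret X: cgset G X using assms by unfold_locales (simp add: finite_cgset_def)
  interpret Y: cgset G Y using assms by unfold_locales (simp add: finite_cgset_def)
  have "small_category (cgset_sum X Y)"
    by unfold_locales (auto simp: X.Cmp_assoc Y.Cmp_assoc)
  then have "categorified_gset G (cgset_sum X Y)"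
    by (auto simp: categorified_gset_def gset_defs)
  then show ?thesis
    using assms by (simp add: finite_cgset_def)
qed

lemma finite_cgset_fibre_prod:
  assumes "finite_cgset G X" "finite_cgset G Y"
  shows "finite_cgset G (cgset_fibre_prod X Y)"
proof -
  interpret X: cgset G X using assms by unfold_locales (simp add: finite_cgset_def)
  interpret Y: cgset G Y using assms by unfold_locales (simp add: finite_cgset_def)
  have "small_category (cgset_fibre_prod X Y)"
    by unfold_locales (auto simp: X.Cmp_assoc Y.Cmp_assoc)
  then have "categorified_gset G (cgset_fibre_prod X Y)"
    by (auto simp: categorified_gset_def gset_defs Y.ArrStr_composable)
      (metis X.ObjAct_Ide, metis X.ArrAct_Ide)
  moreover have "finite (Arr (cgset_fibre_prod X Y))"
    by (rule finite_subset[of _ "Arr X \<times> Arr Y"]) (use assms in \<open>auto simp: finite_cgset_def\<close>)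
  ultimately show ?thesis
    by (simp add: finite_cgset_def)
qed

lemma finite_cgset_empty: "finite_cgset G cgset_empty"
  by (simp add: finite_cgset_def categorified_gset_def gset_defs cgset_empty_def small_category_def)

lemma finite_cgset_unit:
  assumes "small_category G" "finite (Obj G)"
  shows "finite_cgset G (cgset_unit G)"
proof -
  interpret small_category G by fact
  show ?thesis using assms(2)
    by (auto simp: finite_cgset_def categorified_gset_def gset_defs cgset_unit_def small_category_def
        Src_closed Src_Ide Src_Cmp)
qed

section \<open>Sums and fibre products respect weak equivalence\<close>

definition functor_sum ::
  "('x \<Rightarrow> 'u) \<times> ('y \<Rightarrow> 'v) \<Rightarrow> ('w \<Rightarrow> 's) \<times> ('z \<Rightarrow> 't) \<Rightarrow> ('x + 'w \<Rightarrow> 'u + 's) \<times> ('y + 'z \<Rightarrow> 'v + 't)" where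
  "functor_sum \<phi> \<psi> = (map_sum (fst \<phi>) (fst \<psi>), map_sum (snd \<phi>) (snd \<psi>))"

definition functor_prod ::
  "('x \<Rightarrow> 'u) \<times> ('y \<Rightarrow> 'v) \<Rightarrow> ('w \<Rightarrow> 's) \<times> ('z \<Rightarrow> 't) \<Rightarrow> ('x \<times> 'w \<Rightarrow> 'u \<times> 's) \<times> ('y \<times> 'z \<Rightarrow> 'v \<times> 't)" where
  "functor_prod \<phi> \<psi> = (map_prod (fst \<phi>) (fst \<psi>), map_prod (snd \<phi>) (snd \<psi>))"

lemma functor_sum_comp:
  "functor_comp (functor_sum \<phi>' \<psi>') (functor_sum \<phi> \<psi>) = functor_sum (functor_comp \<phi>' \<phi>) (functor_comp \<psi>' \<psi>)"
  by (simp add: functor_sum_def functor_comp_def map_sum.comp)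

lemma functor_prod_comp:
  "functor_comp (functor_prod \<phi>' \<psi>') (functor_prod \<phi> \<psi>) = functor_prod (functor_comp \<phi>' \<phi>) (functor_comp \<psi>' \<psi>)"
  by (simp add: functor_prod_def functor_comp_def map_prod.comp)

lemma functor_sum_id: "functor_sum functor_id functor_id = functor_id"
  by (simp add: functor_sum_def functor_id_def map_sum.id)

lemma functor_prod_id: "functor_prod functor_id functor_id = functor_id"
  by (simp add: functor_prod_def functor_id_def map_prod.id)

lemma internal_functor_sum:
  assumes "internal_functor G X X' \<phi>" "internal_functor G Y Y' \<psi>"
  shows "internal_functor G (cgset_sum X Y) (cgset_sum X' Y') (functor_sum \<phi> \<psi>)"
  using assms by (auto simp: internal_functor_def functor_sum_def gset_defs)

lemma internal_functor_prod:
  assumes "internal_functor G X X' \<phi>" "internal_functor G Y Y' \<psi>"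
  shows "internal_functor G (cgset_fibre_prod X Y) (cgset_fibre_prod X' Y') (functor_prod \<phi> \<psi>)"
  using assms by (auto simp: internal_functor_def functor_prod_def gset_defs)

lemma invertible_nat_trans_sum:
  assumes "invertible_nat_trans G X X' \<phi> \<phi>' \<eta>" "invertible_nat_trans G Y Y' \<psi> \<psi>' \<theta>"
  shows "invertible_nat_trans G (cgset_sum X Y) (cgset_sum X' Y') (functor_sum \<phi> \<psi>) (functor_sum \<phi>' \<psi>') (map_sum \<eta> \<theta>)"
proof -
  obtain \<eta>' where \<eta>': "internal_nat_trans G X X' \<phi>' \<phi> \<eta>'"
    "\<forall>x\<in>Obj X. Cmp X' (\<eta>' x) (\<eta> x) = Ide X' (fst \<phi> x) \<and> Cmp X' (\<eta> x) (\<eta>' x) = Ide X' (fst \<phi>' x)"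
    using assms(1) by (auto simp: invertible_nat_trans_def)
  obtain \<theta>' where \<theta>': "internal_nat_trans G Y Y' \<psi>' \<psi> \<theta>'"
    "\<forall>x\<in>Obj Y. Cmp Y' (\<theta>' x) (\<theta> x) = Ide Y' (fst \<psi> x) \<and> Cmp Y' (\<theta> x) (\<theta>' x) = Ide Y' (fst \<psi>' x)"
    using assms(2) by (auto simp: invertible_nat_trans_def)
  have "internal_nat_trans G X X' \<phi> \<phi>' \<eta>" "internal_nat_trans G Y Y' \<psi> \<psi>' \<theta>"
    using assms by (simp_all add: invertible_nat_trans_def)
  with \<eta>' \<theta>' show ?thesis unfolding invertible_nat_trans_def
    by (intro conjI exI[of _ "map_sum \<eta>' \<theta>'"])
      (auto simp: internal_nat_trans_def functor_sum_def gset_defs)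
qed

lemma invertible_nat_trans_prod:
  assumes "categorified_gset G X" "categorified_gset G Y"
    and "invertible_nat_trans G X X' \<phi> \<phi>' \<eta>" "invertible_nat_trans G Y Y' \<psi> \<psi>' \<theta>"
  shows "invertible_nat_trans G (cgset_fibre_prod X Y) (cgset_fibre_prod X' Y') (functor_prod \<phi> \<psi>) (functor_prod \<phi>' \<psi>') (map_prod \<eta> \<theta>)"
proof -
  interpret X: cgset G X by unfold_locales fact
  interpret Y: cgset G Y by unfold_locales fact
  obtain \<eta>' where \<eta>': "internal_nat_trans G X X' \<phi>' \<phi> \<eta>'"
    "\<forall>x\<in>Obj X. Cmp X' (\<eta>' x) (\<eta> x) = Ide X' (fst \<phi> x) \<and> Cmp X' (\<eta> x) (\<eta>' x) = Ide X' (fst \<phi>' x)"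
    using assms(3) by (auto simp: invertible_nat_trans_def)
  obtain \<theta>' where \<theta>': "internal_nat_trans G Y Y' \<psi>' \<psi> \<theta>'"
    "\<forall>x\<in>Obj Y. Cmp Y' (\<theta>' x) (\<theta> x) = Ide Y' (fst \<psi> x) \<and> Cmp Y' (\<theta> x) (\<theta>' x) = Ide Y' (fst \<psi>' x)"
    using assms(4) by (auto simp: invertible_nat_trans_def)
  have "internal_nat_trans G X X' \<phi> \<phi>' \<eta>" "internal_nat_trans G Y Y' \<psi> \<psi>' \<theta>"
    using assms by (simp_all add: invertible_nat_trans_def)
  with \<eta>' \<theta>' show ?thesis unfolding invertible_nat_trans_def
    by (intro conjI exI[of _ "map_prod \<eta>' \<theta>'"])
      (auto simp: internal_nat_trans_def functor_prod_def gset_defs)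
qed

lemma weakly_equivalent_sum:
  assumes "weakly_equivalent G X X'" "weakly_equivalent G Y Y'"
  shows "weakly_equivalent G (cgset_sum X Y) (cgset_sum X' Y')"
proof -
  obtain \<phi> \<psi> \<eta> \<theta> where 1: "internal_functor G X X' \<phi>" "internal_functor G X' X \<psi>"
    "invertible_nat_trans G X X (functor_comp \<psi> \<phi>) functor_id \<eta>"
    "invertible_nat_trans G X' X' (functor_comp \<phi> \<psi>) functor_id \<theta>"
    using assms(1) unfolding weakly_equivalent_def by blast
  obtain \<phi>' \<psi>' \<eta>' \<theta>' where 2: "internal_functor G Y Y' \<phi>'" "internal_functor G Y' Y \<psi>'"
    "invertible_nat_trans G Y Y (functor_comp \<psi>' \<phi>') functor_id \<eta>'"
    "invertible_nat_trans G Y' Y' (functor_comp \<phi>' \<psi>') functor_id \<theta>'"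
    using assms(2) unfolding weakly_equivalent_def by blast
  show ?thesis unfolding weakly_equivalent_def
    using internal_functor_sum[OF 1(1) 2(1)] internal_functor_sum[OF 1(2) 2(2)]
      invertible_nat_trans_sum[OF 1(3) 2(3)] invertible_nat_trans_sum[OF 1(4) 2(4)]
    unfolding functor_sum_comp[symmetric] functor_sum_id by blast
qed

lemma weakly_equivalent_fibre_prod:
  assumes XY: "categorified_gset G X" "categorified_gset G X'" "categorified_gset G Y" "categorified_gset G Y'"
    and "weakly_equivalent G X X'" "weakly_equivalent G Y Y'"
  shows "weakly_equivalent G (cgset_fibre_prod X Y) (cgset_fibre_prod X' Y')"
proof -
  obtain \<phi> \<psi> \<eta> \<theta> where 1: "internal_functor G X X' \<phi>" "internal_functor G X' X \<psi>"
    "invertible_nat_trans G X X (functor_comp \<psi> \<phi>) functor_id \<eta>"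
    "invertible_nat_trans G X' X' (functor_comp \<phi> \<psi>) functor_id \<theta>"
    using assms(5) unfolding weakly_equivalent_def by blast
  obtain \<phi>' \<psi>' \<eta>' \<theta>' where 2: "internal_functor G Y Y' \<phi>'" "internal_functor G Y' Y \<psi>'"
    "invertible_nat_trans G Y Y (functor_comp \<psi>' \<phi>') functor_id \<eta>'"
    "invertible_nat_trans G Y' Y' (functor_comp \<phi>' \<psi>') functor_id \<theta>'"
    using assms(6) unfolding weakly_equivalent_def by blast
  show ?thesis unfolding weakly_equivalent_def
    using internal_functor_prod[OF 1(1) 2(1)] internal_functor_prod[OF 1(2) 2(2)]
      invertible_nat_trans_prod[OF XY(1,3) 1(3) 2(3)] invertible_nat_trans_prod[OF XY(2,4) 1(4) 2(4)]
    unfolding functor_prod_comp[symmetric] functor_prod_id by blast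
qed

section \<open>Operations on classes and the semiring laws\<close>

lemma burnside_rig_add:
  assumes "finite_cgset G X" "finite_cgset G Y"
  shows "weq_class G X \<oplus>\<^bsub>burnside_rig G\<^esub> weq_class G Y = weq_class G (cgset_sum X Y)"
proof -
  have "weq_class G (cgset_sum X' Y') = weq_class G (cgset_sum X Y)"
    if "X' \<in> weq_class G X" "Y' \<in> weq_class G Y" for X' Y'
    using that assms weakly_equivalent_sum[of G X X' Y Y']
    by (simp add: weq_class_def[of G X] weq_class_def[of G Y] weq_class_eq_iff finite_cgset_sum weakly_equivalent_sym)
  moreover have "weq_class G X \<noteq> {}" "weq_class G Y \<noteq> {}"
    using assms by (simp_all add: weq_class_nonempty)
  ultimately show ?thesis
    by (simp add: burnside_rig_def)
qed

lemma burnside_rig_mult: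
  assumes "finite_cgset G X" "finite_cgset G Y"
  shows "weq_class G X \<otimes>\<^bsub>burnside_rig G\<^esub> weq_class G Y = weq_class G (cgset_fibre_prod X Y)"
proof -
  have "weq_class G (cgset_fibre_prod X' Y') = weq_class G (cgset_fibre_prod X Y)"
    if "X' \<in> weq_class G X" "Y' \<in> weq_class G Y" for X' Y'
    using that assms weakly_equivalent_fibre_prod[of G X X' Y Y']
    by (simp add: weq_class_def[of G X] weq_class_def[of G Y] weq_class_eq_iff finite_cgset_fibre_prod
        finite_cgset_categorified weakly_equivalent_sym)
  moreover have "weq_class G X \<noteq> {}" "weq_class G Y \<noteq> {}"
    using assms by (simp_all add: weq_class_nonempty)
  ultimately show ?thesis
    by (simp add: burnside_rig_def)
qed

lemma weq_class_eqI:
  assumes "finite_cgset G X" "finite_cgset G Y" "cgset_iso G X Y \<phi>"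
  shows "weq_class G X = weq_class G Y"
  using assms by (simp add: weq_class_eq_iff cgset_iso_weakly_equivalent finite_cgset_def)

text \<open>The inverse maps need only be inverse as functions between carriers; their functoriality
  comes for free in \<open>cgset_iso_weakly_equivalent\<close>.\<close>

lemma cgset_isoI:
  assumes "internal_functor G X Y \<phi>"
    and "\<And>x. x \<in> Obj X \<Longrightarrow> f (fst \<phi> x) = x" "\<And>y. y \<in> Obj Y \<Longrightarrow> f y \<in> Obj X \<and> fst \<phi> (f y) = y"
    and "\<And>p. p \<in> Arr X \<Longrightarrow> h (snd \<phi> p) = p" "\<And>q. q \<in> Arr Y \<Longrightarrow> h q \<in> Arr X \<and> snd \<phi> (h q) = q"
  shows "cgset_iso G X Y \<phi>"
proof -
  have "fst \<phi> ` Obj X \<subseteq> Obj Y" "snd \<phi> ` Arr X \<subseteq> Arr Y"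
    using assms(1) by (auto simp: internal_functor_def gset_defs)
  with assms show ?thesis
    unfolding cgset_iso_def
    by (auto intro!: bij_betw_byWitness[of _ f] bij_betw_byWitness[of _ h])
qed

lemma burnside_rig_add_comm:
  fixes G :: "('o, 'g) small_cat"
  assumes "A \<in> carrier (burnside_rig G)" "B \<in> carrier (burnside_rig G)"
  shows "A \<oplus>\<^bsub>burnside_rig G\<^esub> B = B \<oplus>\<^bsub>burnside_rig G\<^esub> A"
proof -
  obtain X :: "(nat, nat, 'o, 'g) cgset" where X: "finite_cgset G X" "A = weq_class G X" using assms(1) by (rule burnside_rig_carrierE)
  obtain Y :: "(nat, nat, 'o, 'g) cgset" where Y: "finite_cgset G Y" "B = weq_class G Y" using assms(2) by (rule burnside_rig_carrierE)
  have "cgset_iso G (cgset_sum X Y) (cgset_sum Y X) (case_sum Inr Inl, case_sum Inr Inl)"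
    by (rule cgset_isoI[where f = "case_sum Inr Inl" and h = "case_sum Inr Inl"])
      (auto simp: internal_functor_def gset_defs)
  then show ?thesis
    using X Y by (simp add: burnside_rig_add weq_class_eqI finite_cgset_sum)
qed

lemma burnside_rig_add_assoc:
  fixes G :: "('o, 'g) small_cat"
  assumes "A \<in> carrier (burnside_rig G)" "B \<in> carrier (burnside_rig G)" "C \<in> carrier (burnside_rig G)"
  shows "A \<oplus>\<^bsub>burnside_rig G\<^esub> B \<oplus>\<^bsub>burnside_rig G\<^esub> C = A \<oplus>\<^bsub>burnside_rig G\<^esub> (B \<oplus>\<^bsub>burnside_rig G\<^esub> C)"
proof -
  obtain X :: "(nat, nat, 'o, 'g) cgset" where X: "finite_cgset G X" "A = weq_class G X" using assms(1) by (rule burnside_rig_carrierE)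
  obtain Y :: "(nat, nat, 'o, 'g) cgset" where Y: "finite_cgset G Y" "B = weq_class G Y" using assms(2) by (rule burnside_rig_carrierE)
  obtain Z :: "(nat, nat, 'o, 'g) cgset" where Z: "finite_cgset G Z" "C = weq_class G Z" using assms(3) by (rule burnside_rig_carrierE)
  have "cgset_iso G (cgset_sum (cgset_sum X Y) Z) (cgset_sum X (cgset_sum Y Z))
    (case_sum (case_sum Inl (Inr \<circ> Inl)) (Inr \<circ> Inr), case_sum (case_sum Inl (Inr \<circ> Inl)) (Inr \<circ> Inr))"
    by (rule cgset_isoI[where f = "case_sum (Inl \<circ> Inl) (case_sum (Inl \<circ> Inr) Inr)"
          and h = "case_sum (Inl \<circ> Inl) (case_sum (Inl \<circ> Inr) Inr)"])
      (auto simp: internal_functor_def gset_defs)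
  then show ?thesis
    using X Y Z by (simp add: burnside_rig_add weq_class_eqI finite_cgset_sum)
qed

lemma burnside_rig_l_distr:
  fixes G :: "('o, 'g) small_cat"
  assumes "A \<in> carrier (burnside_rig G)" "B \<in> carrier (burnside_rig G)" "C \<in> carrier (burnside_rig G)"
  shows "(A \<oplus>\<^bsub>burnside_rig G\<^esub> B) \<otimes>\<^bsub>burnside_rig G\<^esub> C
    = A \<otimes>\<^bsub>burnside_rig G\<^esub> C \<oplus>\<^bsub>burnside_rig G\<^esub> B \<otimes>\<^bsub>burnside_rig G\<^esub> C"
proof -
  obtain X :: "(nat, nat, 'o, 'g) cgset" where X: "finite_cgset G X" "A = weq_class G X" using assms(1) by (rule burnside_rig_carrierE)
  obtain Y :: "(nat, nat, 'o, 'g) cgset" where Y: "finite_cgset G Y" "B = weq_class G Y" using assms(2) by (rule burnside_rig_carrierE)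
  obtain Z :: "(nat, nat, 'o, 'g) cgset" where Z: "finite_cgset G Z" "C = weq_class G Z" using assms(3) by (rule burnside_rig_carrierE)
  have "cgset_iso G (cgset_fibre_prod (cgset_sum X Y) Z) (cgset_sum (cgset_fibre_prod X Z) (cgset_fibre_prod Y Z))
    (\<lambda>(x, z). map_sum (\<lambda>x. (x, z)) (\<lambda>x. (x, z)) x, \<lambda>(x, z). map_sum (\<lambda>x. (x, z)) (\<lambda>x. (x, z)) x)"
    by (rule cgset_isoI[where f = "case_sum (map_prod Inl id) (map_prod Inr id)"
          and h = "case_sum (map_prod Inl id) (map_prod Inr id)"])
      (auto simp: internal_functor_def gset_defs)
  then show ?thesis
    using X Y Z by (simp add: burnside_rig_add burnside_rig_mult weq_class_eqI finite_cgset_sum finite_cgset_fibre_prod)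
qed

text \<open>Proved by its own isomorphism, distributing over the summands in the second factor. It
  is what makes products of formal differences well defined in the second argument.\<close>

lemma burnside_rig_r_distr:
  fixes G :: "('o, 'g) small_cat"
  assumes "A \<in> carrier (burnside_rig G)" "B \<in> carrier (burnside_rig G)" "C \<in> carrier (burnside_rig G)"
  shows "C \<otimes>\<^bsub>burnside_rig G\<^esub> (A \<oplus>\<^bsub>burnside_rig G\<^esub> B)
    = C \<otimes>\<^bsub>burnside_rig G\<^esub> A \<oplus>\<^bsub>burnside_rig G\<^esub> C \<otimes>\<^bsub>burnside_rig G\<^esub> B"
proof -
  obtain X :: "(nat, nat, 'o, 'g) cgset" where X: "finite_cgset G X" "A = weq_class G X" using assms(1) by (rule burnside_rig_carrierE)
  obtain Y :: "(nat, nat, 'o, 'g) cgset" where Y: "finite_cgset G Y" "B = weq_class G Y" using assms(2) by (rule burnside_rig_carrierE)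
  obtain Z :: "(nat, nat, 'o, 'g) cgset" where Z: "finite_cgset G Z" "C = weq_class G Z" using assms(3) by (rule burnside_rig_carrierE)
  interpret Z: cgset G Z using Z by unfold_locales (simp add: finite_cgset_def)
  have "cgset_iso G (cgset_fibre_prod Z (cgset_sum X Y)) (cgset_sum (cgset_fibre_prod Z X) (cgset_fibre_prod Z Y))
    (\<lambda>(z, x). map_sum (\<lambda>x. (z, x)) (\<lambda>x. (z, x)) x, \<lambda>(z, x). map_sum (\<lambda>x. (z, x)) (\<lambda>x. (z, x)) x)"
    by (rule cgset_isoI[where f = "case_sum (map_prod id Inl) (map_prod id Inr)"
          and h = "case_sum (map_prod id Inl) (map_prod id Inr)"])
      (auto simp: internal_functor_def gset_defs)
  then show ?thesis
    using X Y Z by (simp add: burnside_rig_add burnside_rig_mult weq_class_eqI finite_cgset_sum finite_cgset_fibre_prod)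
qed

section \<open>Grothendieck rings of products\<close>

text \<open>Collects the closure properties and laws on which formal differences, their sums and
  their products rest.\<close>

locale prerig =
  fixes R :: "('a, 'm) ring_scheme" (structure)
  assumes add_closed [simp]: "\<lbrakk>x \<in> carrier R; y \<in> carrier R\<rbrakk> \<Longrightarrow> x \<oplus> y \<in> carrier R"
    and mult_closed [simp]: "\<lbrakk>x \<in> carrier R; y \<in> carrier R\<rbrakk> \<Longrightarrow> x \<otimes> y \<in> carrier R"
    and zero_closed [simp]: "\<zero> \<in> carrier R"
    and one_closed [simp]: "\<one> \<in> carrier R"
    and add_assoc: "\<lbrakk>x \<in> carrier R; y \<in> carrier R; z \<in> carrier R\<rbrakk> \<Longrightarrow> x \<oplus> y \<oplus> z = x \<oplus> (y \<oplus> z)"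
    and add_comm: "\<lbrakk>x \<in> carrier R; y \<in> carrier R\<rbrakk> \<Longrightarrow> x \<oplus> y = y \<oplus> x"
    and l_distr: "\<lbrakk>x \<in> carrier R; y \<in> carrier R; z \<in> carrier R\<rbrakk> \<Longrightarrow> (x \<oplus> y) \<otimes> z = x \<otimes> z \<oplus> y \<otimes> z"
    and r_distr: "\<lbrakk>x \<in> carrier R; y \<in> carrier R; z \<in> carrier R\<rbrakk> \<Longrightarrow> z \<otimes> (x \<oplus> y) = z \<otimes> x \<oplus> z \<otimes> y"
begin

lemma add_lcomm: "\<lbrakk>x \<in> carrier R; y \<in> carrier R; z \<in> carrier R\<rbrakk> \<Longrightarrow> x \<oplus> (y \<oplus> z) = y \<oplus> (x \<oplus> z)"
  by (metis add_assoc add_comm)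

lemmas add_ac = add_assoc add_comm add_lcomm

lemma grothendieck_relI:
  assumes "x \<in> carrier R" "y \<in> carrier R" "x' \<in> carrier R" "y' \<in> carrier R" "e \<in> carrier R"
    and "x \<oplus> y' \<oplus> e = x' \<oplus> y \<oplus> e"
  shows "((x, y), (x', y')) \<in> grothendieck_rel R"
  using assms by (auto simp: grothendieck_rel_def)

lemma grothendieck_relE:
  assumes "(p, q) \<in> grothendieck_rel R"
  obtains x y x' y' e where "p = (x, y)" "q = (x', y')"
    "x \<in> carrier R" "y \<in> carrier R" "x' \<in> carrier R" "y' \<in> carrier R" "e \<in> carrier R"
    "x \<oplus> y' \<oplus> e = x' \<oplus> y \<oplus> e"
  using assms by (auto simp: grothendieck_rel_def)

lemma equiv_grothendieck_rel: "equiv (carrier R \<times> carrier R) (grothendieck_rel R)"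
proof (rule equivI)
  show "grothendieck_rel R \<subseteq> (carrier R \<times> carrier R) \<times> carrier R \<times> carrier R"
    by (auto simp: grothendieck_rel_def)
  show "refl_on (carrier R \<times> carrier R) (grothendieck_rel R)"
    by (rule refl_onI) (auto simp: grothendieck_rel_def intro!: bexI[of _ "\<zero>"])
  show "sym (grothendieck_rel R)"
    by (rule symI) (auto simp: grothendieck_rel_def, metis)
  show "trans (grothendieck_rel R)"
  proof (rule transI)
    fix p q r assume "(p, q) \<in> grothendieck_rel R" "(q, r) \<in> grothendieck_rel R"
    then obtain x y x' y' x'' y'' e f where *: "p = (x, y)" "q = (x', y')" "r = (x'', y'')"
      "x \<in> carrier R" "y \<in> carrier R" "x' \<in> carrier R" "y' \<in> carrier R" "e \<in> carrier R"
      "x'' \<in> carrier R" "y'' \<in> carrier R" "f \<in> carrier R"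
      and eq: "x \<oplus> y' \<oplus> e = x' \<oplus> y \<oplus> e" "x' \<oplus> y'' \<oplus> f = x'' \<oplus> y' \<oplus> f"
      by (auto elim!: grothendieck_relE)
    have "x \<oplus> y'' \<oplus> (y' \<oplus> e \<oplus> f) = (x \<oplus> y' \<oplus> e) \<oplus> (y'' \<oplus> f)"
      using * by (simp add: add_ac)
    also have "\<dots> = (x' \<oplus> y'' \<oplus> f) \<oplus> (y \<oplus> e)"
      unfolding eq(1) using * by (simp add: add_ac)
    also have "\<dots> = x'' \<oplus> y \<oplus> (y' \<oplus> e \<oplus> f)"
      unfolding eq(2) using * by (simp add: add_ac)
    finally show "(p, r) \<in> grothendieck_rel R"
      unfolding *(1,3) using * by (intro grothendieck_relI[where e = "y' \<oplus> e \<oplus> f"]) simp_all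
  qed
qed

lemma grothendieck_class_eq_iff:
  assumes "x \<in> carrier R" "y \<in> carrier R" "x' \<in> carrier R" "y' \<in> carrier R"
  shows "grothendieck_class R (x, y) = grothendieck_class R (x', y')
    \<longleftrightarrow> (\<exists>e\<in>carrier R. x \<oplus> y' \<oplus> e = x' \<oplus> y \<oplus> e)"
  unfolding grothendieck_class_def
  using eq_equiv_class_iff[OF equiv_grothendieck_rel, of "(x, y)" "(x', y')"] assms
  by (simp add: grothendieck_rel_def)

lemma grothendieck_carrierE:
  assumes "A \<in> carrier (grothendieck_ring R)"
  obtains x y where "x \<in> carrier R" "y \<in> carrier R" "A = grothendieck_class R (x, y)"
  using assms by (auto simp: grothendieck_ring_def grothendieck_class_def elim!: quotientE)

lemma grothendieck_class_in_carrier: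
  "\<lbrakk>x \<in> carrier R; y \<in> carrier R\<rbrakk> \<Longrightarrow> grothendieck_class R (x, y) \<in> carrier (grothendieck_ring R)"
  by (auto simp: grothendieck_ring_def grothendieck_class_def intro!: quotientI)

lemma grothendieck_add:
  assumes "x \<in> carrier R" "y \<in> carrier R" "u \<in> carrier R" "v \<in> carrier R"
  shows "grothendieck_class R (x, y) \<oplus>\<^bsub>grothendieck_ring R\<^esub> grothendieck_class R (u, v)
    = grothendieck_class R (x \<oplus> u, y \<oplus> v)"
proof -
  \<comment> \<open>Addition is commutative, so compatibility in one argument suffices.\<close>
  have "congruent2 (grothendieck_rel R) (grothendieck_rel R)
    (\<lambda>(x, y) (u, v). grothendieck_class R (x \<oplus> u, y \<oplus> v))"
  proof (rule congruent2_commuteI[OF equiv_grothendieck_rel], goal_cases)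
    case (1 p q)
    then show ?case by (auto simp: add_comm)
  next
    case (2 p q w)
    then obtain x y x' y' e u v where *: "p = (x, y)" "q = (x', y')" "w = (u, v)"
      "x \<in> carrier R" "y \<in> carrier R" "x' \<in> carrier R" "y' \<in> carrier R" "e \<in> carrier R"
      "u \<in> carrier R" "v \<in> carrier R" and eq: "x \<oplus> y' \<oplus> e = x' \<oplus> y \<oplus> e"
      by (auto elim!: grothendieck_relE)
    have "u \<oplus> x \<oplus> (v \<oplus> y') \<oplus> e = u \<oplus> v \<oplus> (x \<oplus> y' \<oplus> e)"
      using * by (simp add: add_ac)
    also have "\<dots> = u \<oplus> x' \<oplus> (v \<oplus> y) \<oplus> e"
      unfolding eq using * by (simp add: add_ac)
    finally show ?case
      using * by (auto simp: grothendieck_class_eq_iff)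
  qed
  from UN_equiv_class2[OF equiv_grothendieck_rel equiv_grothendieck_rel this, of "(x, y)" "(u, v)"]
  show ?thesis using assms
    by (simp add: grothendieck_ring_def grothendieck_class_def case_prod_unfold)
qed

lemma grothendieck_mult:
  assumes "x \<in> carrier R" "y \<in> carrier R" "u \<in> carrier R" "v \<in> carrier R"
  shows "grothendieck_class R (x, y) \<otimes>\<^bsub>grothendieck_ring R\<^esub> grothendieck_class R (u, v)
    = grothendieck_class R (x \<otimes> u \<oplus> y \<otimes> v, x \<otimes> v \<oplus> y \<otimes> u)"
proof -
  have "congruent2 (grothendieck_rel R) (grothendieck_rel R)
    (\<lambda>(x, y) (u, v). grothendieck_class R (x \<otimes> u \<oplus> y \<otimes> v, x \<otimes> v \<oplus> y \<otimes> u))"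
  proof (rule congruent2I[OF equiv_grothendieck_rel equiv_grothendieck_rel], goal_cases)
    case (1 p q w)
    then obtain x y x' y' e u v where *: "p = (x, y)" "q = (x', y')" "w = (u, v)"
      "x \<in> carrier R" "y \<in> carrier R" "x' \<in> carrier R" "y' \<in> carrier R" "e \<in> carrier R"
      "u \<in> carrier R" "v \<in> carrier R" and eq: "x \<oplus> y' \<oplus> e = x' \<oplus> y \<oplus> e"
      by (auto elim!: grothendieck_relE)
    \<comment> \<open>The relation between \<open>p\<close> and \<open>q\<close> is multiplied by
      \<open>u\<close>, its mirror image by \<open>v\<close>, and the two are added. The summand
      \<open>e\<close> thereby becomes the witness
      \<open>e \<otimes> u \<oplus> e \<otimes> v\<close>.\<close>
    have "x \<otimes> u \<oplus> y \<otimes> v \<oplus> (x' \<otimes> v \<oplus> y' \<otimes> u) \<oplus> (e \<otimes> u \<oplus> e \<otimes> v)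
      = (x \<oplus> y' \<oplus> e) \<otimes> u \<oplus> (x' \<oplus> y \<oplus> e) \<otimes> v"
      using * by (simp add: l_distr add_ac)
    also have "\<dots> = (x' \<oplus> y \<oplus> e) \<otimes> u \<oplus> (x \<oplus> y' \<oplus> e) \<otimes> v"
      unfolding eq ..
    also have "\<dots> = x' \<otimes> u \<oplus> y' \<otimes> v \<oplus> (x \<otimes> v \<oplus> y \<otimes> u) \<oplus> (e \<otimes> u \<oplus> e \<otimes> v)"
      using * by (simp add: l_distr add_ac)
    finally show ?case
      using * by (auto simp: grothendieck_class_eq_iff intro!: bexI[of _ "e \<otimes> u \<oplus> e \<otimes> v"])
  next
    case (2 p q w)
    then obtain x y x' y' e u v where *: "p = (x, y)" "q = (x', y')" "w = (u, v)"
      "x \<in> carrier R" "y \<in> carrier R" "x' \<in> carrier R" "y' \<in> carrier R" "e \<in> carrier R"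
      "u \<in> carrier R" "v \<in> carrier R" and eq: "x \<oplus> y' \<oplus> e = x' \<oplus> y \<oplus> e"
      by (auto elim!: grothendieck_relE)
    have "u \<otimes> x \<oplus> v \<otimes> y \<oplus> (u \<otimes> y' \<oplus> v \<otimes> x') \<oplus> (u \<otimes> e \<oplus> v \<otimes> e)
      = u \<otimes> (x \<oplus> y' \<oplus> e) \<oplus> v \<otimes> (x' \<oplus> y \<oplus> e)"
      using * by (simp add: r_distr add_ac)
    also have "\<dots> = u \<otimes> (x' \<oplus> y \<oplus> e) \<oplus> v \<otimes> (x \<oplus> y' \<oplus> e)"
      unfolding eq ..
    also have "\<dots> = u \<otimes> x' \<oplus> v \<otimes> y' \<oplus> (u \<otimes> y \<oplus> v \<otimes> x) \<oplus> (u \<otimes> e \<oplus> v \<otimes> e)"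
      using * by (simp add: r_distr add_ac)
    finally show ?case
      using * by (auto simp: grothendieck_class_eq_iff intro!: bexI[of _ "u \<otimes> e \<oplus> v \<otimes> e"])
  qed
  from UN_equiv_class2[OF equiv_grothendieck_rel equiv_grothendieck_rel this, of "(x, y)" "(u, v)"]
  show ?thesis using assms
    by (simp add: grothendieck_ring_def grothendieck_class_def case_prod_unfold)
qed

end

section \<open>Formal differences in a product of rigs\<close>

lemma product_ring_simps [simp]:
  "carrier (product_ring I S) = (\<Pi>\<^sub>E i\<in>I. carrier (S i))"
  "x \<otimes>\<^bsub>product_ring I S\<^esub> y = (\<lambda>i\<in>I. x i \<otimes>\<^bsub>S i\<^esub> y i)"
  "x \<oplus>\<^bsub>product_ring I S\<^esub> y = (\<lambda>i\<in>I. x i \<oplus>\<^bsub>S i\<^esub> y i)"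
  "\<one>\<^bsub>product_ring I S\<^esub> = (\<lambda>i\<in>I. \<one>\<^bsub>S i\<^esub>)"
  "\<zero>\<^bsub>product_ring I S\<^esub> = (\<lambda>i\<in>I. \<zero>\<^bsub>S i\<^esub>)"
  by (simp_all add: product_ring_def)

text \<open>The unit of a Grothendieck ring is the class of one and zero, whereas
  \<open>ring_hom\<close> speaks of one only; hence the separate premise on zero. Bijectivity of
  \<open>h\<close> is used for more than representatives: it also turns families of auxiliary
  summands into elements of \<open>R\<close>.\<close>

lemma grothendieck_ring_product_iso:
  assumes "prerig R" and "\<And>i. i \<in> I \<Longrightarrow> prerig (S i)"
    and h: "h \<in> ring_iso R (product_ring I S)"
    and h_zero: "h \<zero>\<^bsub>R\<^esub> = \<zero>\<^bsub>product_ring I S\<^esub>"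
  shows "grothendieck_ring R \<simeq> product_ring I (\<lambda>i. grothendieck_ring (S i))"
proof -
  interpret R: prerig R by fact
  have S: "prerig (S i)" if "i \<in> I" for i using assms(2) that .
  note S_simps [simp] = prerig.add_closed[OF S] prerig.mult_closed[OF S]
    prerig.one_closed[OF S] prerig.zero_closed[OF S]
  note S_class = prerig.grothendieck_class_eq_iff[OF S]
  have h_closed: "h x \<in> (\<Pi>\<^sub>E i\<in>I. carrier (S i))" if "x \<in> carrier R" for x
    using h that by (auto simp: ring_iso_def ring_hom_def)
  have h_comp [simp]: "h x i \<in> carrier (S i)" if "x \<in> carrier R" "i \<in> I" for x i
    using h_closed[OF that(1)] that(2) by blast
  have h_add [simp]: "h (x \<oplus>\<^bsub>R\<^esub> y) i = h x i \<oplus>\<^bsub>S i\<^esub> h y i"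
    and h_mult [simp]: "h (x \<otimes>\<^bsub>R\<^esub> y) i = h x i \<otimes>\<^bsub>S i\<^esub> h y i"
    if "x \<in> carrier R" "y \<in> carrier R" "i \<in> I" for x y i
    using h that by (auto simp: ring_iso_def ring_hom_def)
  have h_one [simp]: "h \<one>\<^bsub>R\<^esub> i = \<one>\<^bsub>S i\<^esub>" and h_zero [simp]: "h \<zero>\<^bsub>R\<^esub> i = \<zero>\<^bsub>S i\<^esub>" if "i \<in> I" for i
    using h h_zero that by (auto simp: ring_iso_def ring_hom_def)
  have h_bij: "bij_betw h (carrier R) (\<Pi>\<^sub>E i\<in>I. carrier (S i))"
    using h by (simp add: ring_iso_def)
  have h_eqI: "x = y" if "x \<in> carrier R" "y \<in> carrier R" "\<And>i. i \<in> I \<Longrightarrow> h x i = h y i" for x y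
  proof -
    have "h x = h y" using PiE_ext[OF h_closed h_closed] that by blast
    then show ?thesis using h_bij that by (meson bij_betw_def inj_onD)
  qed
  have h_surj: "\<exists>x\<in>carrier R. \<forall>i\<in>I. h x i = f i" if "\<And>i. i \<in> I \<Longrightarrow> f i \<in> carrier (S i)" for f
  proof -
    have "restrict f I \<in> h ` carrier R"
      using h_bij that by (simp add: bij_betw_def)
    then show ?thesis by (metis imageE restrict_apply')
  qed
  \<comment> \<open>A class has no distinguished representative, so the union runs over all of them;
    \<open>h\<close> respects the relation, which makes all members of the union equal.\<close>
  define k where "k A = (\<lambda>i\<in>I. \<Union>(x, y)\<in>A. grothendieck_class (S i) (h x i, h y i))" for A
  have k_class: "k (grothendieck_class R (x, y)) = (\<lambda>i\<in>I. grothendieck_class (S i) (h x i, h y i))"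
    if "x \<in> carrier R" "y \<in> carrier R" for x y
  proof -
    have "(\<Union>(x, y)\<in>grothendieck_class R (x, y). grothendieck_class (S i) (h x i, h y i))
        = grothendieck_class (S i) (h x i, h y i)" if i: "i \<in> I" for i
    proof -
      have "(\<lambda>(x, y). grothendieck_class (S i) (h x i, h y i)) respects grothendieck_rel R"
      proof (rule congruentI)
        fix p q assume "(p, q) \<in> grothendieck_rel R"
        then obtain x y x' y' e where *: "p = (x, y)" "q = (x', y')"
          "x \<in> carrier R" "y \<in> carrier R" "x' \<in> carrier R" "y' \<in> carrier R" "e \<in> carrier R"
          and eq: "x \<oplus>\<^bsub>R\<^esub> y' \<oplus>\<^bsub>R\<^esub> e = x' \<oplus>\<^bsub>R\<^esub> y \<oplus>\<^bsub>R\<^esub> e"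
          by (rule R.grothendieck_relE)
        have "h x i \<oplus>\<^bsub>S i\<^esub> h y' i \<oplus>\<^bsub>S i\<^esub> h e i = h x' i \<oplus>\<^bsub>S i\<^esub> h y i \<oplus>\<^bsub>S i\<^esub> h e i"
          using arg_cong[OF eq, of "\<lambda>z. h z i"] * i by simp
        then show "(case p of (x, y) \<Rightarrow> grothendieck_class (S i) (h x i, h y i))
          = (case q of (x, y) \<Rightarrow> grothendieck_class (S i) (h x i, h y i))"
          using * i by (auto simp: S_class)
      qed
      from UN_equiv_class[OF R.equiv_grothendieck_rel this, of "(x, y)"] that
      show ?thesis using \<open>x \<in> carrier R\<close> \<open>y \<in> carrier R\<close> by (simp add: grothendieck_class_def)
    qed
    then show ?thesis unfolding k_def by (rule restrict_ext)
  qed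
  have S_carrier: "(\<lambda>i\<in>I. grothendieck_class (S i) (h x i, h y i)) \<in> (\<Pi>\<^sub>E i\<in>I. carrier (grothendieck_ring (S i)))"
    if "x \<in> carrier R" "y \<in> carrier R" for x y
    unfolding restrict_PiE
    by (intro Pi_I prerig.grothendieck_class_in_carrier) (use that S in simp_all)
  have "k \<in> ring_hom (grothendieck_ring R) (product_ring I (\<lambda>i. grothendieck_ring (S i)))"
  proof (rule ring_hom_memI)
    fix A assume "A \<in> carrier (grothendieck_ring R)"
    then show "k A \<in> carrier (product_ring I (\<lambda>i. grothendieck_ring (S i)))"
      by (rule R.grothendieck_carrierE) (simp add: k_class S_carrier del: restrict_PiE)
  next
    fix A B assume "A \<in> carrier (grothendieck_ring R)" "B \<in> carrier (grothendieck_ring R)"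
    then obtain x y u v where *: "x \<in> carrier R" "y \<in> carrier R" "u \<in> carrier R" "v \<in> carrier R"
      "A = grothendieck_class R (x, y)" "B = grothendieck_class R (u, v)"
      by (metis R.grothendieck_carrierE)
    then show "k (A \<otimes>\<^bsub>grothendieck_ring R\<^esub> B) = k A \<otimes>\<^bsub>product_ring I (\<lambda>i. grothendieck_ring (S i))\<^esub> k B"
      by (auto simp: k_class R.grothendieck_mult prerig.grothendieck_mult[OF S] intro!: restrict_ext)
    show "k (A \<oplus>\<^bsub>grothendieck_ring R\<^esub> B) = k A \<oplus>\<^bsub>product_ring I (\<lambda>i. grothendieck_ring (S i))\<^esub> k B"
      using * by (auto simp: k_class R.grothendieck_add prerig.grothendieck_add[OF S] intro!: restrict_ext)
  next
    show "k \<one>\<^bsub>grothendieck_ring R\<^esub> = \<one>\<^bsub>product_ring I (\<lambda>i. grothendieck_ring (S i))\<^esub>"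
      using k_class[of "\<one>\<^bsub>R\<^esub>" "\<zero>\<^bsub>R\<^esub>"] by (auto simp: grothendieck_ring_def intro!: restrict_ext)
  qed
  moreover have "inj_on k (carrier (grothendieck_ring R))"
  proof (rule inj_onI)
    fix A B assume "A \<in> carrier (grothendieck_ring R)" "B \<in> carrier (grothendieck_ring R)" and AB: "k A = k B"
    then obtain x y u v where *: "x \<in> carrier R" "y \<in> carrier R" "u \<in> carrier R" "v \<in> carrier R"
      "A = grothendieck_class R (x, y)" "B = grothendieck_class R (u, v)"
      by (metis R.grothendieck_carrierE)
    have "\<exists>e\<in>carrier (S i). h x i \<oplus>\<^bsub>S i\<^esub> h v i \<oplus>\<^bsub>S i\<^esub> e = h u i \<oplus>\<^bsub>S i\<^esub> h y i \<oplus>\<^bsub>S i\<^esub> e" if "i \<in> I" for i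
      using fun_cong[OF AB, of i] * that by (simp add: k_class S_class)
    then obtain e where e: "\<And>i. i \<in> I \<Longrightarrow> e i \<in> carrier (S i)"
      "\<And>i. i \<in> I \<Longrightarrow> h x i \<oplus>\<^bsub>S i\<^esub> h v i \<oplus>\<^bsub>S i\<^esub> e i = h u i \<oplus>\<^bsub>S i\<^esub> h y i \<oplus>\<^bsub>S i\<^esub> e i"
      by metis
    \<comment> \<open>Equality of classes provides an independent summand in each factor;
      surjectivity of \<open>h\<close> glues this family into one summand in
      \<open>R\<close>.\<close>
    obtain e' where e': "e' \<in> carrier R" "\<forall>i\<in>I. h e' i = e i"
      using h_surj[OF e(1)] by blast
    have "x \<oplus>\<^bsub>R\<^esub> v \<oplus>\<^bsub>R\<^esub> e' = u \<oplus>\<^bsub>R\<^esub> y \<oplus>\<^bsub>R\<^esub> e'"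
      using * e e' by (intro h_eqI) simp_all
    then show "A = B"
      using * e' by (auto simp: R.grothendieck_class_eq_iff)
  qed
  moreover have "F \<in> k ` carrier (grothendieck_ring R)"
    if F: "F \<in> (\<Pi>\<^sub>E i\<in>I. carrier (grothendieck_ring (S i)))" for F
  proof -
    have "\<exists>x y. x \<in> carrier (S i) \<and> y \<in> carrier (S i) \<and> F i = grothendieck_class (S i) (x, y)" if "i \<in> I" for i
      using prerig.grothendieck_carrierE[OF S[OF that], of "F i"] F that by (metis PiE_mem)
    then obtain f g where fg: "\<And>i. i \<in> I \<Longrightarrow> f i \<in> carrier (S i)" "\<And>i. i \<in> I \<Longrightarrow> g i \<in> carrier (S i)"
      "\<And>i. i \<in> I \<Longrightarrow> F i = grothendieck_class (S i) (f i, g i)"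
      by metis
    obtain x where x: "x \<in> carrier R" "\<forall>i\<in>I. h x i = f i" using h_surj[OF fg(1)] by blast
    obtain y where y: "y \<in> carrier R" "\<forall>i\<in>I. h y i = g i" using h_surj[OF fg(2)] by blast
    have "F = (\<lambda>i\<in>I. grothendieck_class (S i) (h x i, h y i))"
      using F x(2) y(2) fg(3) by (intro extensionalityI[of _ I]) (auto simp: PiE_def)
    then have "F = k (grothendieck_class R (x, y))"
      using x y by (simp add: k_class)
    then show ?thesis
      using x y R.grothendieck_class_in_carrier by blast
  qed
  ultimately have "k \<in> ring_iso (grothendieck_ring R) (product_ring I (\<lambda>i. grothendieck_ring (S i)))"
    by (auto simp: ring_iso_def bij_betw_def ring_hom_def)
  then show ?thesis by (auto simp: is_ring_iso_def)
qed

section \<open>Fibres over the objects of a groupoid\<close>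

lemma prerig_burnside_rig:
  assumes "small_category G" "finite (Obj G)"
  shows "prerig (burnside_rig G)"
proof
  show "A \<oplus>\<^bsub>burnside_rig G\<^esub> B \<in> carrier (burnside_rig G)"
    if "A \<in> carrier (burnside_rig G)" "B \<in> carrier (burnside_rig G)" for A B
    using that by (auto elim!: burnside_rig_carrierE
        simp: burnside_rig_add finite_cgset_sum intro!: weq_class_in_carrier)
  show "A \<otimes>\<^bsub>burnside_rig G\<^esub> B \<in> carrier (burnside_rig G)"
    if "A \<in> carrier (burnside_rig G)" "B \<in> carrier (burnside_rig G)" for A B
    using that by (auto elim!: burnside_rig_carrierE
        simp: burnside_rig_mult finite_cgset_fibre_prod intro!: weq_class_in_carrier)
  show "\<zero>\<^bsub>burnside_rig G\<^esub> \<in> carrier (burnside_rig G)"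
    using weq_class_in_carrier[OF finite_cgset_empty, of G] by (simp add: burnside_rig_def)
  show "\<one>\<^bsub>burnside_rig G\<^esub> \<in> carrier (burnside_rig G)"
    using weq_class_in_carrier[OF finite_cgset_unit[OF assms]] by (simp add: burnside_rig_def)
qed (fact burnside_rig_add_assoc burnside_rig_add_comm burnside_rig_l_distr burnside_rig_r_distr)+

lemma isotropy_simps [simp]:
  "Obj (isotropy G a) = {a}"
  "Arr (isotropy G a) = {g \<in> Arr G. Src G g = a \<and> Trg G g = a}"
  "Src (isotropy G a) = Src G"
  "Trg (isotropy G a) = Trg G"
  "Ide (isotropy G a) = Ide G"
  "Cmp (isotropy G a) = Cmp G"
  by (simp_all add: isotropy_def)

lemma small_category_isotropy:
  assumes "small_category G" "a \<in> Obj G"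
  shows "small_category (isotropy G a)"
proof -
  interpret small_category G by fact
  show ?thesis using assms(2)
    by unfold_locales (auto simp: Ide_closed Src_Ide Trg_Ide Cmp_closed Src_Cmp Trg_Cmp Cmp_assoc,
        metis Cmp_Ide_left, metis Cmp_Ide_right)
qed

text \<open>Only the carriers shrink, while all operations stay as they are. Commutation with sums,
  fibre products and units is therefore an equality of records, and a functor restricts to a fibre
  without being changed.\<close>

definition fibre :: "'o \<Rightarrow> ('x, 'y, 'o, 'g) cgset \<Rightarrow> ('x, 'y, 'o, 'g) cgset" where
  "fibre a X = X\<lparr>Obj := {x \<in> Obj X. ObjStr X x = a}, Arr := {p \<in> Arr X. ArrStr X p = a}\<rparr>"

lemma fibre_simps [simp]:
  "Obj (fibre a X) = {x \<in> Obj X. ObjStr X x = a}"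
  "Arr (fibre a X) = {p \<in> Arr X. ArrStr X p = a}"
  "Src (fibre a X) = Src X"
  "Trg (fibre a X) = Trg X"
  "Ide (fibre a X) = Ide X"
  "Cmp (fibre a X) = Cmp X"
  "ObjStr (fibre a X) = ObjStr X"
  "ObjAct (fibre a X) = ObjAct X"
  "ArrStr (fibre a X) = ArrStr X"
  "ArrAct (fibre a X) = ArrAct X"
  by (simp_all add: fibre_def)

lemma finite_cgset_fibre:
  assumes "finite_cgset G X"
  shows "finite_cgset (isotropy G a) (fibre a X)"
proof -
  interpret cgset G X using assms by unfold_locales (simp add: finite_cgset_def)
  have "small_category (fibre a X)"
    by unfold_locales (auto simp: Cmp_assoc)
  then have "categorified_gset (isotropy G a) (fibre a X)"
    by (auto simp: categorified_gset_def gset_defs)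
  then show ?thesis using assms by (simp add: finite_cgset_def)
qed

lemma Plus_case_sum_eq:
  "{z \<in> Sum_Type.Plus A B. case_sum f h z = a} = Sum_Type.Plus {x \<in> A. f x = a} {y \<in> B. h y = a}"
  by auto

lemma fibre_sum: "fibre a (cgset_sum X Y) = cgset_sum (fibre a X) (fibre a Y)"
  by (simp add: fibre_def cgset_sum_def Plus_case_sum_eq) (simp add: fun_eq_iff split: sum.splits)

lemma fibre_fibre_prod: "fibre a (cgset_fibre_prod X Y) = cgset_fibre_prod (fibre a X) (fibre a Y)"
  by (auto simp: fibre_def cgset_fibre_prod_def)

lemma fibre_unit: "a \<in> Obj G \<Longrightarrow> fibre a (cgset_unit G) = cgset_unit (isotropy G a)"
  by (auto simp: fibre_def cgset_unit_def)

lemma fibre_empty: "fibre a cgset_empty = cgset_empty"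
  by (simp add: fibre_def cgset_empty_def)

lemma internal_functor_fibre:
  "internal_functor G X Y \<phi> \<Longrightarrow> internal_functor (isotropy G a) (fibre a X) (fibre a Y) \<phi>"
  by (simp add: internal_functor_def gset_defs)

lemma internal_nat_trans_fibre:
  "internal_nat_trans G X Y \<phi> \<psi> \<eta> \<Longrightarrow> internal_nat_trans (isotropy G a) (fibre a X) (fibre a Y) \<phi> \<psi> \<eta>"
  by (simp add: internal_nat_trans_def gset_defs)

lemma invertible_nat_trans_fibre:
  "invertible_nat_trans G X Y \<phi> \<psi> \<eta> \<Longrightarrow> invertible_nat_trans (isotropy G a) (fibre a X) (fibre a Y) \<phi> \<psi> \<eta>"
  unfolding invertible_nat_trans_def by (auto intro!: internal_nat_trans_fibre)

lemma weakly_equivalent_fibre: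
  "weakly_equivalent G X Y \<Longrightarrow> weakly_equivalent (isotropy G a) (fibre a X) (fibre a Y)"
  unfolding weakly_equivalent_def by (meson internal_functor_fibre invertible_nat_trans_fibre)

text \<open>The conditions on a transformation evaluate the functors on carriers only. This allows a
  functor given on one fibre to be exchanged for a global functor that agrees with it there.\<close>

lemma invertible_nat_trans_cong:
  assumes "categorified_gset G X" "invertible_nat_trans G X Y \<phi> \<psi> \<eta>"
    and "\<And>x. x \<in> Obj X \<Longrightarrow> fst \<phi> x = fst \<phi>' x" "\<And>p. p \<in> Arr X \<Longrightarrow> snd \<phi> p = snd \<phi>' p"
    and "\<And>x. x \<in> Obj X \<Longrightarrow> fst \<psi> x = fst \<psi>' x" "\<And>p. p \<in> Arr X \<Longrightarrow> snd \<psi> p = snd \<psi>' p"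
  shows "invertible_nat_trans G X Y \<phi>' \<psi>' \<eta>"
  using assms by (simp add: invertible_nat_trans_def internal_nat_trans_def)

text \<open>Makes arguments by translation along \<open>G\<close> available for composable pairs, as
  needed for preservation of composition.\<close>

lemma (in cgset) composable_right_gset: "right_gset G (composable_gset X)"
proof -
  have "ArrAct X q (Ide G (ArrStr X p)) = q"
    if "p \<in> Arr X" "q \<in> Arr X" "Src X p = Trg X q" for p q
    using that by (metis ArrStr_composable ArrAct_Ide)
  then show ?thesis
    by (auto simp: gset_defs ArrStr_composable)
qed

text \<open>\<open>\<tau>' b\<close> is the inverse of \<open>\<tau> b\<close>. Normalising both to
  identities on \<open>R\<close> ensures that an extension agrees exactly with the data prescribed
  over \<open>R\<close>.\<close>

locale transversal = groupoid G for G :: "('o, 'g) small_cat" +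
  fixes R :: "'o set" and \<rho> :: "'o \<Rightarrow> 'o" and \<tau> \<tau>' :: "'o \<Rightarrow> 'g"
  assumes R_subset: "a \<in> R \<Longrightarrow> a \<in> Obj G"
    and \<rho>_closed [simp]: "b \<in> Obj G \<Longrightarrow> \<rho> b \<in> R"
    and \<rho>_component: "g \<in> Arr G \<Longrightarrow> \<rho> (Trg G g) = \<rho> (Src G g)"
    and \<tau> [simp]: "b \<in> Obj G \<Longrightarrow> \<tau> b \<in> Arr G" "b \<in> Obj G \<Longrightarrow> Src G (\<tau> b) = \<rho> b" "b \<in> Obj G \<Longrightarrow> Trg G (\<tau> b) = b"
    and \<tau>' [simp]: "b \<in> Obj G \<Longrightarrow> \<tau>' b \<in> Arr G" "b \<in> Obj G \<Longrightarrow> Src G (\<tau>' b) = b" "b \<in> Obj G \<Longrightarrow> Trg G (\<tau>' b) = \<rho> b"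
    and \<tau>_\<tau>' [simp]: "b \<in> Obj G \<Longrightarrow> Cmp G (\<tau> b) (\<tau>' b) = Ide G b" "b \<in> Obj G \<Longrightarrow> Cmp G (\<tau>' b) (\<tau> b) = Ide G (\<rho> b)"
    and on_R [simp]: "a \<in> R \<Longrightarrow> \<rho> a = a" "a \<in> R \<Longrightarrow> \<tau> a = Ide G a" "a \<in> R \<Longrightarrow> \<tau>' a = Ide G a"

lemma transversal_exists:
  assumes "groupoid G" "component_representatives G R"
  obtains \<rho> \<tau> \<tau>' where "transversal G R \<rho> \<tau> \<tau>'"
proof -
  interpret groupoid G by fact
  have R: "R \<subseteq> Obj G" and
    ex1: "\<And>x. x \<in> Obj G \<Longrightarrow> \<exists>!a. a \<in> R \<and> (\<exists>g\<in>Arr G. Src G g = x \<and> Trg G g = a)"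
    using assms(2) by (auto simp: component_representatives_def)
  have "\<exists>a t t'. a \<in> R \<and> t \<in> Arr G \<and> Src G t = a \<and> Trg G t = b \<and> t' \<in> Arr G \<and> Src G t' = b \<and> Trg G t' = a
    \<and> Cmp G t t' = Ide G b \<and> Cmp G t' t = Ide G a \<and> (b \<in> R \<longrightarrow> a = b \<and> t = Ide G b \<and> t' = Ide G b)"
    if b: "b \<in> Obj G" for b
  proof (cases "b \<in> R")
    \<comment> \<open>The normalisation dictates the identity here. Off \<open>R\<close>,
      \<open>\<tau>'\<close> is an arrow to the representative and \<open>\<tau>\<close> its
      inverse.\<close>
    case True
    have "Cmp G (Ide G b) (Ide G b) = Ide G b"
      using b by (metis Cmp_Ide_right Ide_closed Src_Ide)
    with True b show ?thesis by (auto simp: Ide_closed Src_Ide Trg_Ide)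
  next
    case False
    obtain a g where g: "a \<in> R" "g \<in> Arr G" "Src G g = b" "Trg G g = a"
      using ex1[OF b] by blast
    with invertible[OF g(2)] False show ?thesis by blast
  qed
  then obtain \<rho> \<tau> \<tau>' where *: "\<And>b. b \<in> Obj G \<Longrightarrow> \<rho> b \<in> R \<and> \<tau> b \<in> Arr G \<and> Src G (\<tau> b) = \<rho> b \<and> Trg G (\<tau> b) = b \<and>
    \<tau>' b \<in> Arr G \<and> Src G (\<tau>' b) = b \<and> Trg G (\<tau>' b) = \<rho> b
    \<and> Cmp G (\<tau> b) (\<tau>' b) = Ide G b \<and> Cmp G (\<tau>' b) (\<tau> b) = Ide G (\<rho> b) \<and> (b \<in> R \<longrightarrow> \<rho> b = b \<and> \<tau> b = Ide G b \<and> \<tau>' b = Ide G b)"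
    by metis
  have "\<rho> (Trg G g) = \<rho> (Src G g)" if g: "g \<in> Arr G" for g
  proof -
    have o: "Src G g \<in> Obj G" "Trg G g \<in> Obj G"
      using g by (simp_all add: Src_closed Trg_closed)
    \<comment> \<open>This composite connects \<open>Src G g\<close> with the representative of
      \<open>Trg G g\<close>, so uniqueness of representatives identifies the two values of
      \<open>\<rho>\<close>.\<close>
    have "Cmp G (\<tau>' (Trg G g)) g \<in> Arr G" "Src G (Cmp G (\<tau>' (Trg G g)) g) = Src G g"
      "Trg G (Cmp G (\<tau>' (Trg G g)) g) = \<rho> (Trg G g)"
      using g *[OF o(2)] by (simp_all add: Cmp_closed Src_Cmp Trg_Cmp)
    then show ?thesis using ex1[OF o(1)] *[OF o(1)] *[OF o(2)] by metis
  qed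
  with R * have "transversal G R \<rho> \<tau> \<tau>'"
    by unfold_locales (simp_all add: subset_iff)
  with that show ?thesis .
qed

definition gset_fibre :: "'o \<Rightarrow> ('x, 'o, 'g) gset \<Rightarrow> ('x, 'o, 'g) gset" where
  "gset_fibre a P = P\<lparr>Pts := {x \<in> Pts P. Str P x = a}\<rparr>"

section \<open>The retraction onto isotropy groups and induction along translations\<close>

context transversal
begin

lemma category_simps [simp]:
  "f \<in> Arr G \<Longrightarrow> Src G f \<in> Obj G" "f \<in> Arr G \<Longrightarrow> Trg G f \<in> Obj G"
  "b \<in> Obj G \<Longrightarrow> Ide G b \<in> Arr G" "b \<in> Obj G \<Longrightarrow> Src G (Ide G b) = b" "b \<in> Obj G \<Longrightarrow> Trg G (Ide G b) = b"
  "\<lbrakk>f \<in> Arr G; g \<in> Arr G; Src G f = Trg G g\<rbrakk> \<Longrightarrow> Cmp G f g \<in> Arr G"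
  "\<lbrakk>f \<in> Arr G; g \<in> Arr G; Src G f = Trg G g\<rbrakk> \<Longrightarrow> Src G (Cmp G f g) = Src G g"
  "\<lbrakk>f \<in> Arr G; g \<in> Arr G; Src G f = Trg G g\<rbrakk> \<Longrightarrow> Trg G (Cmp G f g) = Trg G f"
  "f \<in> Arr G \<Longrightarrow> Cmp G (Ide G (Trg G f)) f = f" "f \<in> Arr G \<Longrightarrow> Cmp G f (Ide G (Src G f)) = f"
  by (fact Src_closed Trg_closed Ide_closed Src_Ide Trg_Ide Cmp_closed Src_Cmp Trg_Cmp
      Cmp_Ide_left Cmp_Ide_right)+

lemma \<rho>_Obj [simp]: "b \<in> Obj G \<Longrightarrow> \<rho> b \<in> Obj G"
  by (simp add: R_subset)

text \<open>\<open>\<kappa>\<close> is a functor retracting \<open>G\<close> onto the disjoint union of the isotropy groups over \<open>R\<close>.\<close>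

definition \<kappa> :: "'g \<Rightarrow> 'g" where
  "\<kappa> g = Cmp G (\<tau>' (Trg G g)) (Cmp G g (\<tau> (Src G g)))"

lemma \<kappa>_simps [simp]:
  assumes "g \<in> Arr G"
  shows "\<kappa> g \<in> Arr G" "Src G (\<kappa> g) = \<rho> (Src G g)" "Trg G (\<kappa> g) = \<rho> (Src G g)"
  using assms by (simp_all add: \<kappa>_def \<rho>_component)

text \<open>Naturality of \<open>\<tau>\<close> as a transformation from the retraction
  \<open>\<kappa>\<close> to the identity of \<open>G\<close>; the next lemma is naturality of its
  inverse.\<close>

lemma \<tau>_\<kappa>: "g \<in> Arr G \<Longrightarrow> Cmp G (\<tau> (Trg G g)) (\<kappa> g) = Cmp G g (\<tau> (Src G g))"
  unfolding \<kappa>_def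
  by (subst Cmp_assoc[symmetric]) (simp_all, metis Cmp_Ide_left category_simps(6,8) \<tau>(1,3) Src_closed)

lemma \<kappa>_\<tau>': "g \<in> Arr G \<Longrightarrow> Cmp G (\<kappa> g) (\<tau>' (Src G g)) = Cmp G (\<tau>' (Trg G g)) g"
  unfolding \<kappa>_def by (simp add: Cmp_assoc)

lemma \<kappa>_Ide: "b \<in> Obj G \<Longrightarrow> \<kappa> (Ide G b) = Ide G (\<rho> b)"
  unfolding \<kappa>_def by simp (metis Cmp_Ide_left \<tau>(1,3) \<tau>_\<tau>'(2))

lemma \<kappa>_Cmp:
  assumes "g \<in> Arr G" "h \<in> Arr G" "Src G g = Trg G h"
  shows "\<kappa> (Cmp G g h) = Cmp G (\<kappa> g) (\<kappa> h)"
proof -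
  \<comment> \<open>The factor \<open>\<tau>'\<close> of \<open>\<kappa> h\<close> at the middle
    object is absorbed by \<open>\<kappa> g\<close>, which leaves a single conjugation of the
    composite.\<close>
  have "Cmp G (\<kappa> g) (\<kappa> h) = Cmp G (Cmp G (\<kappa> g) (\<tau>' (Src G g))) (Cmp G h (\<tau> (Src G h)))"
    using assms unfolding \<kappa>_def[of h] by (subst Cmp_assoc) simp_all
  also have "\<dots> = \<kappa> (Cmp G g h)"
    using assms unfolding \<kappa>_\<tau>'[OF assms(1)] by (simp add: \<kappa>_def Cmp_assoc)
  finally show ?thesis ..
qed

lemma \<kappa>_R: "\<lbrakk>g \<in> Arr G; Src G g \<in> R; Trg G g = Src G g\<rbrakk> \<Longrightarrow> \<kappa> g = g"
  by (simp add: \<kappa>_def) (metis Cmp_Ide_left)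

text \<open>Acting by \<open>\<tau>\<close> moves a point into a fibre over \<open>R\<close>, and
  acting by \<open>\<tau>'\<close> brings it back. A property stable under the action therefore has
  to be checked over \<open>R\<close> only; equations between equivariant maps are of this
  kind.\<close>

lemma gset_induct:
  assumes "right_gset G P" "x \<in> Pts P"
    and "\<And>x. \<lbrakk>x \<in> Pts P; Str P x \<in> R\<rbrakk> \<Longrightarrow> E x"
    and "\<And>x g. \<lbrakk>x \<in> Pts P; g \<in> Arr G; Str P x = Trg G g; E x\<rbrakk> \<Longrightarrow> E (Act P x g)"
  shows "E x"
proof -
  let ?b = "Str P x" and ?y = "Act P x (\<tau> (Str P x))"
  have b: "?b \<in> Obj G" using assms by (simp add: right_gset_def)
  then have y: "?y \<in> Pts P" "Str P ?y = \<rho> ?b" "Act P ?y (\<tau>' ?b) = x"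
    using assms(1,2) by (auto simp: right_gset_def)
  have "E ?y" using y b by (intro assms(3)) simp_all
  then show "E x" using assms(4)[OF y(1), of "\<tau>' ?b"] y b by simp
qed

lemma Obj_induct [consumes 2, case_names base step]:
  assumes "categorified_gset G X" "x \<in> Obj X"
    and "\<And>x. \<lbrakk>x \<in> Obj X; ObjStr X x \<in> R\<rbrakk> \<Longrightarrow> E x"
    and "\<And>x g. \<lbrakk>x \<in> Obj X; g \<in> Arr G; ObjStr X x = Trg G g; E x\<rbrakk> \<Longrightarrow> E (ObjAct X x g)"
  shows "E x"
  using gset_induct[of "obj_gset X" x E] assms
  by (simp add: categorified_gset_def obj_gset_def)

lemma Arr_induct [consumes 2, case_names base step]:
  assumes "categorified_gset G X" "p \<in> Arr X"
    and "\<And>p. \<lbrakk>p \<in> Arr X; ArrStr X p \<in> R\<rbrakk> \<Longrightarrow> E p"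
    and "\<And>p g. \<lbrakk>p \<in> Arr X; g \<in> Arr G; ArrStr X p = Trg G g; E p\<rbrakk> \<Longrightarrow> E (ArrAct X p g)"
  shows "E p"
  using gset_induct[of "arr_gset X" p E] assms
  by (simp add: categorified_gset_def arr_gset_def)

lemma composable_induct [consumes 4, case_names base step]:
  assumes "categorified_gset G X" "p \<in> Arr X" "q \<in> Arr X" "Src X p = Trg X q"
    and "\<And>p q. \<lbrakk>p \<in> Arr X; q \<in> Arr X; Src X p = Trg X q; ArrStr X p \<in> R; ArrStr X q = ArrStr X p\<rbrakk> \<Longrightarrow> E p q"
    and "\<And>p q g. \<lbrakk>p \<in> Arr X; q \<in> Arr X; Src X p = Trg X q; g \<in> Arr G; ArrStr X p = Trg G g; ArrStr X q = Trg G g; E p q\<rbrakk>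
      \<Longrightarrow> E (ArrAct X p g) (ArrAct X q g)"
  shows "E p q"
proof -
  interpret cgset G X by unfold_locales fact
  have "case (p, q) of (p, q) \<Rightarrow> E p q"
    by (rule gset_induct[OF composable_right_gset])
      (use assms in \<open>auto simp: composable_gset_def ArrStr_composable\<close>)
  then show ?thesis by simp
qed

section \<open>Extension of maps, functors and transformations from the fibres over
  \<open>R\<close>\<close>

lemma equivariant_extension:
  assumes P: "right_gset G P" and Q: "right_gset G Q"
    and F: "\<And>a. a \<in> R \<Longrightarrow> equivariant (isotropy G a) (gset_fibre a P) (gset_fibre a Q) (F a)"
  obtains F' where "equivariant G P Q F'" "\<And>x. \<lbrakk>x \<in> Pts P; Str P x \<in> R\<rbrakk> \<Longrightarrow> F' x = F (Str P x) x"
proof -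
  have Psimps: "\<And>x. x \<in> Pts P \<Longrightarrow> Str P x \<in> Obj G"
    "\<And>x g. \<lbrakk>x \<in> Pts P; g \<in> Arr G; Str P x = Trg G g\<rbrakk> \<Longrightarrow> Act P x g \<in> Pts P"
    "\<And>x g. \<lbrakk>x \<in> Pts P; g \<in> Arr G; Str P x = Trg G g\<rbrakk> \<Longrightarrow> Str P (Act P x g) = Src G g"
    "\<And>x. x \<in> Pts P \<Longrightarrow> Act P x (Ide G (Str P x)) = x"
    "\<And>x g h. \<lbrakk>x \<in> Pts P; g \<in> Arr G; h \<in> Arr G; Str P x = Trg G g; Src G g = Trg G h\<rbrakk>
      \<Longrightarrow> Act P (Act P x g) h = Act P x (Cmp G g h)"
    using P by (simp_all add: right_gset_def)
  have Qsimps: "\<And>x. x \<in> Pts Q \<Longrightarrow> Str Q x \<in> Obj G"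
    "\<And>x g. \<lbrakk>x \<in> Pts Q; g \<in> Arr G; Str Q x = Trg G g\<rbrakk> \<Longrightarrow> Act Q x g \<in> Pts Q"
    "\<And>x g. \<lbrakk>x \<in> Pts Q; g \<in> Arr G; Str Q x = Trg G g\<rbrakk> \<Longrightarrow> Str Q (Act Q x g) = Src G g"
    "\<And>x. x \<in> Pts Q \<Longrightarrow> Act Q x (Ide G (Str Q x)) = x"
    "\<And>x g h. \<lbrakk>x \<in> Pts Q; g \<in> Arr G; h \<in> Arr G; Str Q x = Trg G g; Src G g = Trg G h\<rbrakk>
      \<Longrightarrow> Act Q (Act Q x g) h = Act Q x (Cmp G g h)"
    using Q by (simp_all add: right_gset_def)
  have Fsimps: "F a x \<in> Pts Q" "Str Q (F a x) = a" if "a \<in> R" "x \<in> Pts P" "Str P x = a" for a x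
    using F[OF that(1)] that(2,3) by (simp_all add: equivariant_def gset_fibre_def)
  have Fact: "F a (Act P x g) = Act Q (F a x) g"
    if "a \<in> R" "x \<in> Pts P" "Str P x = a" "g \<in> Arr G" "Src G g = a" "Trg G g = a" for a x g
    using F[OF that(1)] that(2-) by (simp add: equivariant_def gset_fibre_def)
  \<comment> \<open>The only possible value: move to the representative, apply the given map there,
    and move back.\<close>
  define F' where "F' x = Act Q (F (\<rho> (Str P x)) (Act P x (\<tau> (Str P x)))) (\<tau>' (Str P x))" for x
  have "F' (Act P x g) = Act Q (F' x) g" if x: "x \<in> Pts P" and g: "g \<in> Arr G" "Str P x = Trg G g" for x g
  proof -
    let ?a = "\<rho> (Src G g)" and ?y = "Act P x (\<tau> (Trg G g))"
    have y: "?y \<in> Pts P" "Str P ?y = ?a"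
      using x g by (simp_all add: Psimps \<rho>_component)
    \<comment> \<open>By naturality of \<open>\<tau>\<close>, acting by \<open>g\<close> and then by
      \<open>\<tau>\<close> is acting by \<open>\<tau>\<close> and then by
      \<open>\<kappa> g\<close>. The latter is a loop at a representative, so the given map commutes
      with it.\<close>
    have "F' (Act P x g) = Act Q (F ?a (Act P ?y (\<kappa> g))) (\<tau>' (Src G g))"
      using x g by (simp add: F'_def Psimps \<rho>_component \<tau>_\<kappa>)
    also have "\<dots> = Act Q (F ?a ?y) (Cmp G (\<tau>' (Trg G g)) g)"
      using y g by (simp add: Fact Fsimps Qsimps \<kappa>_\<tau>')
    also have "\<dots> = Act Q (F' x) g"
      using y g by (simp add: F'_def Qsimps Fsimps \<rho>_component)
    finally show ?thesis .
  qed
  then have "equivariant G P Q F'"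
    by (simp add: equivariant_def F'_def Psimps Qsimps Fsimps)
  moreover have "F' x = F (Str P x) x" if "x \<in> Pts P" "Str P x \<in> R" for x
    using that Qsimps(4)[OF Fsimps(1)] by (simp add: F'_def Psimps Qsimps Fsimps)
  ultimately show ?thesis using that by blast
qed

text \<open>The maps on objects and on arrows are extended independently of each other. Their
  compatibility with source, target, identities and composition holds over \<open>R\<close> and is
  carried to the other fibres by equivariance.\<close>

lemma internal_functor_extension:
  assumes X: "categorified_gset G X" and Y: "categorified_gset G Y"
    and \<phi>: "\<And>a. a \<in> R \<Longrightarrow> internal_functor (isotropy G a) (fibre a X) (fibre a Y) (\<phi> a)"
  obtains \<Phi> where "internal_functor G X Y \<Phi>"
    "\<And>x. \<lbrakk>x \<in> Obj X; ObjStr X x \<in> R\<rbrakk> \<Longrightarrow> fst \<Phi> x = fst (\<phi> (ObjStr X x)) x"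
    "\<And>p. \<lbrakk>p \<in> Arr X; ArrStr X p \<in> R\<rbrakk> \<Longrightarrow> snd \<Phi> p = snd (\<phi> (ArrStr X p)) p"
proof -
  interpret X: cgset G X by unfold_locales fact
  interpret Y: cgset G Y by unfold_locales fact
  obtain f where f: "equivariant G (obj_gset X) (obj_gset Y) f"
    and fR: "\<And>x. \<lbrakk>x \<in> Obj X; ObjStr X x \<in> R\<rbrakk> \<Longrightarrow> f x = fst (\<phi> (ObjStr X x)) x"
    using equivariant_extension[OF X.obj_right_gset Y.obj_right_gset, of "\<lambda>a. fst (\<phi> a)"] \<phi>
    by (auto simp: internal_functor_def obj_gset_def gset_fibre_def)
  obtain h where h: "equivariant G (arr_gset X) (arr_gset Y) h"
    and hR: "\<And>p. \<lbrakk>p \<in> Arr X; ArrStr X p \<in> R\<rbrakk> \<Longrightarrow> h p = snd (\<phi> (ArrStr X p)) p"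
    using equivariant_extension[OF X.arr_right_gset Y.arr_right_gset, of "\<lambda>a. snd (\<phi> a)"] \<phi>
    by (auto simp: internal_functor_def arr_gset_def gset_fibre_def)
  have f_simps [simp]: "x \<in> Obj X \<Longrightarrow> f x \<in> Obj Y" "x \<in> Obj X \<Longrightarrow> ObjStr Y (f x) = ObjStr X x"
    "\<lbrakk>x \<in> Obj X; g \<in> Arr G; ObjStr X x = Trg G g\<rbrakk> \<Longrightarrow> f (ObjAct X x g) = ObjAct Y (f x) g" for x g
    using f by (simp_all add: gset_defs)
  have h_simps [simp]: "p \<in> Arr X \<Longrightarrow> h p \<in> Arr Y" "p \<in> Arr X \<Longrightarrow> ArrStr Y (h p) = ArrStr X p"
    "\<lbrakk>p \<in> Arr X; g \<in> Arr G; ArrStr X p = Trg G g\<rbrakk> \<Longrightarrow> h (ArrAct X p g) = ArrAct Y (h p) g" for p g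
    using h by (simp_all add: gset_defs)
  have "Src Y (h p) = f (Src X p) \<and> Trg Y (h p) = f (Trg X p)" if "p \<in> Arr X" for p
    using X that
  proof (induction rule: Arr_induct)
    case (base p)
    then show ?case using \<phi>[OF base(2)] by (simp add: fR hR internal_functor_def)
  qed simp
  moreover have "h (Ide X x) = Ide Y (f x)" if "x \<in> Obj X" for x
    using X that
  proof (induction rule: Obj_induct)
    case (base x)
    then show ?case using \<phi>[OF base(2)] by (simp add: fR hR internal_functor_def)
  qed (simp flip: X.Ide_Act Y.Ide_Act, simp)
  moreover have "h (Cmp X p q) = Cmp Y (h p) (h q)" if "p \<in> Arr X" "q \<in> Arr X" "Src X p = Trg X q" for p q
    using X that
  proof (induction rule: composable_induct)
    case (base p q)
    then show ?case using \<phi>[OF base(4)] by (simp add: fR hR internal_functor_def)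
  next
    \<comment> \<open>Compatibility with source and target is already available; it makes
      \<open>h p\<close> and \<open>h q\<close> composable, as the equivariance of composition in
      \<open>Y\<close> demands.\<close>
    case (step p q g)
    then show ?case using calculation(1) by simp
  qed
  ultimately have "internal_functor G X Y (f, h)"
    using f h by (simp add: internal_functor_def)
  with fR hR show ?thesis using that by fastforce
qed

lemma internal_nat_trans_extension:
  assumes X: "categorified_gset G X" and Y: "categorified_gset G Y"
    and \<Phi>: "internal_functor G X Y \<Phi>" and \<Psi>: "internal_functor G X Y \<Psi>"
    and \<eta>: "\<And>a. a \<in> R \<Longrightarrow> internal_nat_trans (isotropy G a) (fibre a X) (fibre a Y) \<Phi> \<Psi> (\<eta> a)"
  obtains \<eta>' where "internal_nat_trans G X Y \<Phi> \<Psi> \<eta>'"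
    "\<And>x. \<lbrakk>x \<in> Obj X; ObjStr X x \<in> R\<rbrakk> \<Longrightarrow> \<eta>' x = \<eta> (ObjStr X x) x"
proof -
  interpret \<Phi>: cgset_functor G X Y \<Phi> using assms by unfold_locales
  interpret \<Psi>: cgset_functor G X Y \<Psi> using assms by unfold_locales
  obtain f where f: "equivariant G (obj_gset X) (arr_gset Y) f"
    and fR: "\<And>x. \<lbrakk>x \<in> Obj X; ObjStr X x \<in> R\<rbrakk> \<Longrightarrow> f x = \<eta> (ObjStr X x) x"
    using equivariant_extension[OF \<Phi>.X.obj_right_gset \<Phi>.Y.arr_right_gset, of \<eta>] \<eta>
    by (auto simp: internal_nat_trans_def obj_gset_def arr_gset_def gset_fibre_def)
  have f_simps [simp]: "x \<in> Obj X \<Longrightarrow> f x \<in> Arr Y" "x \<in> Obj X \<Longrightarrow> ArrStr Y (f x) = ObjStr X x"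
    "\<lbrakk>x \<in> Obj X; g \<in> Arr G; ObjStr X x = Trg G g\<rbrakk> \<Longrightarrow> f (ObjAct X x g) = ArrAct Y (f x) g" for x g
    using f by (simp_all add: gset_defs)
  have st: "Src Y (f x) = fst \<Phi> x \<and> Trg Y (f x) = fst \<Psi> x" if "x \<in> Obj X" for x
    using X that
  proof (induction rule: Obj_induct)
    case (base x)
    then show ?case using \<eta>[OF base(2)] by (simp add: fR internal_nat_trans_def)
  qed simp
  have "Cmp Y (snd \<Psi> p) (f (Src X p)) = Cmp Y (f (Trg X p)) (snd \<Phi> p)" if "p \<in> Arr X" for p
    using X that
  proof (induction rule: Arr_induct)
    case (base p)
    then show ?case using \<eta>[OF base(2)] by (simp add: fR internal_nat_trans_def)
  next
    case (step p g)
    then show ?case by (simp add: st)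
  qed
  then have "internal_nat_trans G X Y \<Phi> \<Psi> f"
    using f st by (simp add: internal_nat_trans_def)
  with fR that show ?thesis by blast
qed

text \<open>Local transformations and local inverses are extended separately. That the extensions
  remain inverse is again an equation between equivariant maps, inherited from the fibres over
  \<open>R\<close>.\<close>

lemma invertible_nat_trans_extension:
  assumes X: "categorified_gset G X" and Y: "categorified_gset G Y"
    and \<Phi>: "internal_functor G X Y \<Phi>" and \<Psi>: "internal_functor G X Y \<Psi>"
    and \<eta>: "\<And>a. a \<in> R \<Longrightarrow> \<exists>\<eta>. invertible_nat_trans (isotropy G a) (fibre a X) (fibre a Y) \<Phi> \<Psi> \<eta>"
  shows "\<exists>\<eta>. invertible_nat_trans G X Y \<Phi> \<Psi> \<eta>"
proof -
  interpret \<Phi>: cgset_functor G X Y \<Phi> using assms by unfold_locales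
  interpret \<Psi>: cgset_functor G X Y \<Psi> using assms by unfold_locales
  have "\<exists>\<eta> \<theta>. internal_nat_trans (isotropy G a) (fibre a X) (fibre a Y) \<Phi> \<Psi> \<eta> \<and>
    internal_nat_trans (isotropy G a) (fibre a X) (fibre a Y) \<Psi> \<Phi> \<theta> \<and>
    (\<forall>x\<in>Obj X. ObjStr X x = a \<longrightarrow>
      Cmp Y (\<theta> x) (\<eta> x) = Ide Y (fst \<Phi> x) \<and> Cmp Y (\<eta> x) (\<theta> x) = Ide Y (fst \<Psi> x))" if "a \<in> R" for a
    using \<eta>[OF that] by (auto simp: invertible_nat_trans_def)
  then obtain \<eta> \<theta> where loc:
    "\<And>a. a \<in> R \<Longrightarrow> internal_nat_trans (isotropy G a) (fibre a X) (fibre a Y) \<Phi> \<Psi> (\<eta> a)"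
    "\<And>a. a \<in> R \<Longrightarrow> internal_nat_trans (isotropy G a) (fibre a X) (fibre a Y) \<Psi> \<Phi> (\<theta> a)"
    "\<And>a. a \<in> R \<Longrightarrow> \<forall>x\<in>Obj X. ObjStr X x = a \<longrightarrow>
      Cmp Y (\<theta> a x) (\<eta> a x) = Ide Y (fst \<Phi> x) \<and> Cmp Y (\<eta> a x) (\<theta> a x) = Ide Y (fst \<Psi> x)"
    by metis
  obtain \<eta>' where \<eta>': "internal_nat_trans G X Y \<Phi> \<Psi> \<eta>'"
    "\<And>x. \<lbrakk>x \<in> Obj X; ObjStr X x \<in> R\<rbrakk> \<Longrightarrow> \<eta>' x = \<eta> (ObjStr X x) x"
    using internal_nat_trans_extension[OF X Y \<Phi> \<Psi> loc(1)] by blast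
  obtain \<theta>' where \<theta>': "internal_nat_trans G X Y \<Psi> \<Phi> \<theta>'"
    "\<And>x. \<lbrakk>x \<in> Obj X; ObjStr X x \<in> R\<rbrakk> \<Longrightarrow> \<theta>' x = \<theta> (ObjStr X x) x"
    using internal_nat_trans_extension[OF X Y \<Psi> \<Phi> loc(2)] by blast
  note [simp] = nat_trans_facts(1-5)[OF \<eta>'(1)] nat_trans_facts(1-5)[OF \<theta>'(1)]
  have "Cmp Y (\<theta>' x) (\<eta>' x) = Ide Y (fst \<Phi> x) \<and> Cmp Y (\<eta>' x) (\<theta>' x) = Ide Y (fst \<Psi> x)"
    if "x \<in> Obj X" for x
    using X that
  proof (induction rule: Obj_induct)
    case (base x)
    then show ?case using loc(3)[OF base(2)] by (simp add: \<eta>'(2) \<theta>'(2))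
  next
    case (step x g)
    then show ?case by simp
  qed
  with \<eta>'(1) \<theta>'(1) show ?thesis
    unfolding invertible_nat_trans_def by blast
qed

lemma weakly_equivalent_extension:
  assumes X: "categorified_gset G X" and Y: "categorified_gset G Y"
    and fib: "\<And>a. a \<in> R \<Longrightarrow> categorified_gset (isotropy G a) (fibre a X)"
      "\<And>a. a \<in> R \<Longrightarrow> categorified_gset (isotropy G a) (fibre a Y)"
    and weq: "\<And>a. a \<in> R \<Longrightarrow> weakly_equivalent (isotropy G a) (fibre a X) (fibre a Y)"
  shows "weakly_equivalent G X Y"
proof -
  obtain \<phi> \<psi> where
    \<phi>: "\<And>a. a \<in> R \<Longrightarrow> internal_functor (isotropy G a) (fibre a X) (fibre a Y) (\<phi> a)" and
    \<psi>: "\<And>a. a \<in> R \<Longrightarrow> internal_functor (isotropy G a) (fibre a Y) (fibre a X) (\<psi> a)" and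
    \<eta>: "\<And>a. a \<in> R \<Longrightarrow> \<exists>\<eta>. invertible_nat_trans (isotropy G a) (fibre a X) (fibre a X) (functor_comp (\<psi> a) (\<phi> a)) functor_id \<eta>" and
    \<theta>: "\<And>a. a \<in> R \<Longrightarrow> \<exists>\<theta>. invertible_nat_trans (isotropy G a) (fibre a Y) (fibre a Y) (functor_comp (\<phi> a) (\<psi> a)) functor_id \<theta>"
    using weq unfolding weakly_equivalent_def by metis
  obtain \<Phi> where \<Phi>: "internal_functor G X Y \<Phi>"
    "\<And>x. \<lbrakk>x \<in> Obj X; ObjStr X x \<in> R\<rbrakk> \<Longrightarrow> fst \<Phi> x = fst (\<phi> (ObjStr X x)) x"
    "\<And>p. \<lbrakk>p \<in> Arr X; ArrStr X p \<in> R\<rbrakk> \<Longrightarrow> snd \<Phi> p = snd (\<phi> (ArrStr X p)) p"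
    using internal_functor_extension[OF X Y \<phi>] by blast
  obtain \<Psi> where \<Psi>: "internal_functor G Y X \<Psi>"
    "\<And>x. \<lbrakk>x \<in> Obj Y; ObjStr Y x \<in> R\<rbrakk> \<Longrightarrow> fst \<Psi> x = fst (\<psi> (ObjStr Y x)) x"
    "\<And>p. \<lbrakk>p \<in> Arr Y; ArrStr Y p \<in> R\<rbrakk> \<Longrightarrow> snd \<Psi> p = snd (\<psi> (ArrStr Y p)) p"
    using internal_functor_extension[OF Y X \<psi>] by blast
  interpret \<Phi>: cgset_functor G X Y \<Phi> using X Y \<Phi>(1) by unfold_locales
  interpret \<Psi>: cgset_functor G Y X \<Psi> using X Y \<Psi>(1) by unfold_locales
  have "\<exists>\<eta>. invertible_nat_trans (isotropy G a) (fibre a X) (fibre a X) (functor_comp \<Psi> \<Phi>) functor_id \<eta>" if a: "a \<in> R" for a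
  proof -
    \<comment> \<open>The first functor preserves structure values, so its image stays over
      \<open>a\<close>, where the extension of the second agrees with the given one.\<close>
    have obj: "fst (\<psi> a) (fst (\<phi> a) x) = fst \<Psi> (fst \<Phi> x)" if "x \<in> Obj X" "ObjStr X x = a" for x
      using that a by (metis \<Phi>(2) \<Psi>(2) \<Phi>.functor_facts(1,2))
    have arr: "snd (\<psi> a) (snd (\<phi> a) x) = snd \<Psi> (snd \<Phi> x)" if "x \<in> Arr X" "ArrStr X x = a" for x
      using that a by (metis \<Phi>(3) \<Psi>(3) \<Phi>.functor_facts(4,5))
    obtain \<eta> where "invertible_nat_trans (isotropy G a) (fibre a X) (fibre a X) (functor_comp (\<psi> a) (\<phi> a)) functor_id \<eta>"
      using \<eta>[OF a] by blast
    then have "invertible_nat_trans (isotropy G a) (fibre a X) (fibre a X) (functor_comp \<Psi> \<Phi>) functor_id \<eta>"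
      by (rule invertible_nat_trans_cong[OF fib(1)[OF a]])
        (auto simp: functor_comp_def obj arr)
    then show ?thesis by blast
  qed
  then have 1: "\<exists>\<eta>. invertible_nat_trans G X X (functor_comp \<Psi> \<Phi>) functor_id \<eta>"
    by (intro invertible_nat_trans_extension X internal_functor_comp[OF \<Phi>(1) \<Psi>(1) X] internal_functor_id)
  have "\<exists>\<eta>. invertible_nat_trans (isotropy G a) (fibre a Y) (fibre a Y) (functor_comp \<Phi> \<Psi>) functor_id \<eta>" if a: "a \<in> R" for a
  proof -
    have obj: "fst (\<phi> a) (fst (\<psi> a) x) = fst \<Phi> (fst \<Psi> x)" if "x \<in> Obj Y" "ObjStr Y x = a" for x
      using that a by (metis \<Psi>(2) \<Phi>(2) \<Psi>.functor_facts(1,2))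
    have arr: "snd (\<phi> a) (snd (\<psi> a) x) = snd \<Phi> (snd \<Psi> x)" if "x \<in> Arr Y" "ArrStr Y x = a" for x
      using that a by (metis \<Psi>(3) \<Phi>(3) \<Psi>.functor_facts(4,5))
    obtain \<theta> where "invertible_nat_trans (isotropy G a) (fibre a Y) (fibre a Y) (functor_comp (\<phi> a) (\<psi> a)) functor_id \<theta>"
      using \<theta>[OF a] by blast
    then have "invertible_nat_trans (isotropy G a) (fibre a Y) (fibre a Y) (functor_comp \<Phi> \<Psi>) functor_id \<theta>"
      by (rule invertible_nat_trans_cong[OF fib(2)[OF a]])
        (auto simp: functor_comp_def obj arr)
    then show ?thesis by blast
  qed
  then have 2: "\<exists>\<eta>. invertible_nat_trans G Y Y (functor_comp \<Phi> \<Psi>) functor_id \<eta>"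
    by (intro invertible_nat_trans_extension Y internal_functor_comp[OF \<Psi>(1) \<Phi>(1) Y] internal_functor_id)
  show ?thesis
    unfolding weakly_equivalent_def using \<Phi>(1) \<Psi>(1) 1 2 by blast
qed

end

section \<open>Induction from isotropy groups\<close>

context transversal
begin

text \<open>The family is pulled back along the retraction: \<open>g\<close> changes the label to
  \<open>Src G g\<close> and acts on the second component through \<open>\<kappa> g\<close>. Since
  \<open>\<rho>\<close> is constant on components, the second component stays in the same member of
  the family.\<close>

definition induced :: "('o \<Rightarrow> ('x, 'y, 'o, 'g) cgset) \<Rightarrow> ('o \<times> 'x, 'o \<times> 'y, 'o, 'g) cgset" where
  "induced Y =
    \<lparr>Obj = (SIGMA b:Obj G. Obj (Y (\<rho> b))),
     Arr = (SIGMA b:Obj G. Arr (Y (\<rho> b))),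
     Src = \<lambda>(b, p). (b, Src (Y (\<rho> b)) p),
     Trg = \<lambda>(b, p). (b, Trg (Y (\<rho> b)) p),
     Ide = \<lambda>(b, x). (b, Ide (Y (\<rho> b)) x),
     Cmp = \<lambda>(b, p) (c, q). (b, Cmp (Y (\<rho> b)) p q),
     ObjStr = fst,
     ObjAct = \<lambda>(b, x) g. (Src G g, ObjAct (Y (\<rho> b)) x (\<kappa> g)),
     ArrStr = fst,
     ArrAct = \<lambda>(b, p) g. (Src G g, ArrAct (Y (\<rho> b)) p (\<kappa> g))\<rparr>"

lemma finite_cgset_induced:
  assumes "finite (Obj G)" and Y: "\<And>a. a \<in> R \<Longrightarrow> finite_cgset (isotropy G a) (Y a)"
  shows "finite_cgset G (induced Y)"
proof -
  have cg: "cgset (isotropy G (\<rho> b)) (Y (\<rho> b))" if "b \<in> Obj G" for b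
    using Y[of "\<rho> b"] that by unfold_locales (simp add: finite_cgset_def)
  note Y_facts = cgset.cgset_facts[OF cg]
  have "small_category (Y (\<rho> b))" if "b \<in> Obj G" for b
    using cgset.categorified[OF cg[OF that]] by (simp add: categorified_gset_def)
  note Y_assoc = small_category.Cmp_assoc[OF this]
  \<comment> \<open>A structure map into a groupoid with one object has only one possible
    value.\<close>
  have Y_Str [simp]: "b \<in> Obj G \<Longrightarrow> x \<in> Obj (Y (\<rho> b)) \<Longrightarrow> ObjStr (Y (\<rho> b)) x = \<rho> b"
    "b \<in> Obj G \<Longrightarrow> p \<in> Arr (Y (\<rho> b)) \<Longrightarrow> ArrStr (Y (\<rho> b)) p = \<rho> b" for b x p
    using cgset.ObjStr_closed[OF cg, of b x] cgset.ArrStr_closed[OF cg, of b p] by simp_all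
  have Y_Ide: "b \<in> Obj G \<Longrightarrow> x \<in> Obj (Y (\<rho> b)) \<Longrightarrow> ObjAct (Y (\<rho> b)) x (Ide G (\<rho> b)) = x"
    "b \<in> Obj G \<Longrightarrow> p \<in> Arr (Y (\<rho> b)) \<Longrightarrow> ArrAct (Y (\<rho> b)) p (Ide G (\<rho> b)) = p" for b x p
    using cgset.ObjAct_Ide[OF cg, of b x] cgset.ArrAct_Ide[OF cg, of b p] by simp_all
  have "small_category (induced Y)"
    by unfold_locales (auto simp: induced_def Y_facts Y_assoc)
  then have "categorified_gset G (induced Y)"
    by (auto simp: categorified_gset_def gset_defs induced_def Y_facts Y_Ide \<kappa>_Ide \<kappa>_Cmp \<rho>_component)
  moreover have "finite (Arr (induced Y))"
    using assms by (auto simp: induced_def finite_cgset_def)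
  ultimately show ?thesis by (simp add: finite_cgset_def)
qed

text \<open>On the isotropy group at a representative \<open>\<kappa>\<close> is the identity, so
  dropping the constant label \<open>a\<close> is equivariant.\<close>

lemma fibre_induced_iso:
  assumes "a \<in> R" and Y: "categorified_gset (isotropy G a) (Y a)"
  shows "cgset_iso (isotropy G a) (fibre a (induced Y)) (Y a) (snd, snd)"
proof -
  interpret Y: cgset "isotropy G a" "Y a" by unfold_locales fact
  have "ObjStr (Y a) x = a" if "x \<in> Obj (Y a)" for x using Y.ObjStr_closed[OF that] by simp
  moreover have "ArrStr (Y a) p = a" if "p \<in> Arr (Y a)" for p using Y.ArrStr_closed[OF that] by simp
  ultimately show ?thesis using assms(1)
    by (intro cgset_isoI[where f = "Pair a" and h = "Pair a"])
      (auto simp: internal_functor_def gset_defs induced_def \<kappa>_R R_subset)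
qed

end

section \<open>The isomorphism of rigs\<close>

definition rig_fibres ::
  "('o, 'g) small_cat \<Rightarrow> 'o set \<Rightarrow> (nat, nat, 'o, 'g) cgset set \<Rightarrow> 'o \<Rightarrow> (nat, nat, 'o, 'g) cgset set" where
  "rig_fibres G R A = (\<lambda>a\<in>R. \<Union>X\<in>A. weq_class (isotropy G a) (fibre a X))"

lemma rig_fibres_class:
  assumes X: "finite_cgset G X"
  shows "rig_fibres G R (weq_class G X) = (\<lambda>a\<in>R. weq_class (isotropy G a) (fibre a X))"
proof -
  have "weq_class (isotropy G a) (fibre a X') = weq_class (isotropy G a) (fibre a X)"
    if "X' \<in> weq_class G X" for a X'
    using that X weakly_equivalent_fibre[of G X X' a]
    by (simp add: weq_class_def[of G X] weq_class_eq_iff finite_cgset_fibre weakly_equivalent_sym)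
  then show ?thesis
    using weq_class_nonempty[OF X] by (simp add: rig_fibres_def)
qed

lemma rig_fibres_zero:
  "rig_fibres G R \<zero>\<^bsub>burnside_rig G\<^esub> = \<zero>\<^bsub>product_ring R (\<lambda>a. burnside_rig (isotropy G a))\<^esub>"
  using rig_fibres_class[OF finite_cgset_empty, where R = R and G = G] by (simp add: burnside_rig_def fibre_empty)

lemma rig_fibres_ring_iso:
  fixes G :: "('o, 'g) small_cat"
  assumes "groupoid G" "finite (Obj G)" "component_representatives G R"
  shows "rig_fibres G R \<in> ring_iso (burnside_rig G) (product_ring R (\<lambda>a. burnside_rig (isotropy G a)))"
proof -
  let ?h = "rig_fibres G R" and ?P = "product_ring R (\<lambda>a. burnside_rig (isotropy G a))"
  obtain \<rho> \<tau> \<tau>' where "transversal G R \<rho> \<tau> \<tau>'"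
    using transversal_exists[OF assms(1,3)] .
  then interpret transversal G R \<rho> \<tau> \<tau>' .
  have "?h \<in> ring_hom (burnside_rig G) ?P"
  proof (rule ring_hom_memI)
    fix A assume "A \<in> carrier (burnside_rig G)"
    then obtain X :: "(nat, nat, 'o, 'g) cgset" where X: "finite_cgset G X" "A = weq_class G X"
      by (rule burnside_rig_carrierE)
    then show "?h A \<in> carrier ?P"
      by (simp add: rig_fibres_class weq_class_in_carrier finite_cgset_fibre)
    fix B assume "B \<in> carrier (burnside_rig G)"
    then obtain Y :: "(nat, nat, 'o, 'g) cgset" where Y: "finite_cgset G Y" "B = weq_class G Y"
      by (rule burnside_rig_carrierE)
    show "?h (A \<otimes>\<^bsub>burnside_rig G\<^esub> B) = ?h A \<otimes>\<^bsub>?P\<^esub> ?h B"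
      using X Y by (auto simp: burnside_rig_mult rig_fibres_class finite_cgset_fibre_prod finite_cgset_fibre
          fibre_fibre_prod intro!: restrict_ext)
    show "?h (A \<oplus>\<^bsub>burnside_rig G\<^esub> B) = ?h A \<oplus>\<^bsub>?P\<^esub> ?h B"
      using X Y by (auto simp: burnside_rig_add rig_fibres_class finite_cgset_sum finite_cgset_fibre
          fibre_sum intro!: restrict_ext)
  next
    show "?h \<one>\<^bsub>burnside_rig G\<^esub> = \<one>\<^bsub>?P\<^esub>"
      using rig_fibres_class[OF finite_cgset_unit[OF small_category_axioms assms(2)], where R = R]
      by (auto simp: burnside_rig_def fibre_unit R_subset intro!: restrict_ext)
  qed
  moreover have "inj_on ?h (carrier (burnside_rig G))"
  proof (rule inj_onI)
    fix A B assume "A \<in> carrier (burnside_rig G)" "B \<in> carrier (burnside_rig G)" and eq: "?h A = ?h B"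
    obtain X :: "(nat, nat, 'o, 'g) cgset" where X: "finite_cgset G X" "A = weq_class G X"
      using \<open>A \<in> _\<close> by (rule burnside_rig_carrierE)
    obtain Y :: "(nat, nat, 'o, 'g) cgset" where Y: "finite_cgset G Y" "B = weq_class G Y"
      using \<open>B \<in> _\<close> by (rule burnside_rig_carrierE)
    have "weakly_equivalent (isotropy G a) (fibre a X) (fibre a Y)" if "a \<in> R" for a
      using fun_cong[OF eq, of a] X Y that
      by (simp add: rig_fibres_class weq_class_eq_iff finite_cgset_fibre)
    then have "weakly_equivalent G X Y"
      using X(1) Y(1) by (intro weakly_equivalent_extension) (simp_all add: finite_cgset_categorified finite_cgset_fibre)
    then show "A = B"
      using X Y by (simp add: weq_class_eq_iff)
  qed
  moreover have "F \<in> ?h ` carrier (burnside_rig G)" if F: "F \<in> carrier ?P" for F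
  proof -
    have "\<exists>Y :: (nat, nat, 'o, 'g) cgset. finite_cgset (isotropy G a) Y \<and> F a = weq_class (isotropy G a) Y"
      if "a \<in> R" for a
    proof -
      have "F a \<in> carrier (burnside_rig (isotropy G a))" using F that by auto
      then show ?thesis by (rule burnside_rig_carrierE) blast
    qed
    then obtain Y :: "'o \<Rightarrow> (nat, nat, 'o, 'g) cgset" where
      Y: "\<And>a. a \<in> R \<Longrightarrow> finite_cgset (isotropy G a) (Y a)" "\<And>a. a \<in> R \<Longrightarrow> F a = weq_class (isotropy G a) (Y a)"
      by metis
    have I: "finite_cgset G (induced Y)"
      using finite_cgset_induced[OF assms(2)] Y(1) by blast
    have "weq_class (isotropy G a) (fibre a (induced Y)) = F a" if "a \<in> R" for a
      using weq_class_eqI[OF finite_cgset_fibre[OF I] Y(1)[OF that] fibre_induced_iso] that Y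
      by (simp add: finite_cgset_categorified)
    then have "(\<lambda>a\<in>R. weq_class (isotropy G a) (fibre a (induced Y))) = F"
      using F by (intro extensionalityI[of _ R]) (auto simp: PiE_def)
    then have "?h (weq_class G (induced Y)) = F"
      by (simp add: rig_fibres_class[OF I])
    \<comment> \<open>\<open>induced Y\<close> lives over pairs, not over \<open>nat\<close>; its
      class belongs to the carrier by way of a numbered copy.\<close>
    then show ?thesis
      using weq_class_in_carrier[OF I] by blast
  qed
  ultimately show ?thesis
    by (auto simp: ring_iso_def bij_betw_def ring_hom_def)
qed

theorem corollary7p11:
  fixes G :: "('o, 'g) small_cat" and rep :: "'o set"
  assumes "groupoid G"
    and "finite (Obj G)"
    and "component_representatives G rep"
  shows "burnside_ring G \<simeq> product_ring rep (\<lambda>a. burnside_ring (isotropy G a))"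
proof -
  interpret groupoid G by fact
  have "prerig (burnside_rig (isotropy G a))" if "a \<in> rep" for a
    using that assms(3) by (intro prerig_burnside_rig small_category_isotropy small_category_axioms)
      (auto simp: component_representatives_def)
  then show ?thesis
    unfolding burnside_ring_def
    using grothendieck_ring_product_iso[OF prerig_burnside_rig[OF small_category_axioms assms(2)]
        _ rig_fibres_ring_iso[OF assms] rig_fibres_zero] by blast
qed

end
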